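(* Let $\Lambda\subset\mathbb{D}$ be a uniformly dense sequence and let $\varphi:(0,1]\to(0,1)$ be a non-decreasing continuous function bounded by some constant less than $1$. The set $\Lambda(\varphi)=\bigcup_{\lambda\in\Lambda}D(\lambda,\varphi(1-|\lambda|))$ is sampling for $\mathcal{N}$ if and only if $$\int_0^1\frac{dt}{t\log(1/\varphi(t))}=\infty.$$
   Context: $\mathbb{D}$ is the open unit disk, $\rho(z,w)=\left|\frac{z-w}{1-z\bar w}\right|$, and $D(z,r)=\{w\in\mathbb{D}:\rho(z,w)<r\}$ for $r\in(0,1)$. A sequence $\Lambda\subset\mathbb{D}$ is uniformly dense if (i) it is separated: $\inf_{\lambda\neq\lambda'}\rho(\lambda,\lambda')>0$, and (ii) there exists $r<1$ such that $\mathbb{D}=\bigcup_{\lambda\in\Lambda}D(\lambda,r)$. The Nevanlinna class is $\mathcal{N}=\{f\in \mathrm{Hol}(\mathbb{D}):\lim_{r\to1}\frac1{2\pi}\int_0^{2\pi}\log^+|f(re^{i\theta})|\,d\theta<\infty\}$; $\mathrm{Har}_+(\mathbb{D})$ is the set of non-negative harmonic functions on $\mathbb{D}$. For $f\in\mathcal{N}$ and $E\subset\mathbb{D}$ put $N(f)=\inf\{h(0): h\in\mathrm{Har}_+(\mathbb{D}),\ \log(1+|f|)\le h \text{ on } \mathbb{D}\}$ and $N(f|E)=\inf\{h(0): h\in\mathrm{Har}_+(\mathbb{D}),\ \log(1+|f(z)|)\le h(z)\ \forall z\in E\}$. $E$ is sampling for $\mathcal{N}$ if there exists $C>0$ such that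 $N(f)\le N(f|E)+C$ for all $f\in\mathcal{N}$. *)

theory Defs
  imports "HOL-Complex_Analysis.Complex_Analysis"
begin

abbreviation unit_disc :: "complex set" where
  "unit_disc \<equiv> ball 0 1"

definition ph_dist :: "complex \<Rightarrow> complex \<Rightarrow> real" where
  "ph_dist z w = norm ((z - w) / (1 - z * cnj w))"

definition ph_disc :: "complex \<Rightarrow> real \<Rightarrow> complex set" where
  "ph_disc z r = {w \<in> unit_disc. ph_dist z w < r}"

text \<open>A sequence without repeated points is represented by the set of its points;
  separation already makes such a set countable.\<close>

definition separated :: "complex set \<Rightarrow> bool" where
  "separated \<Lambda> \<longleftrightarrow> (\<exists>\<delta>>0. \<forall>z\<in>\<Lambda>. \<forall>w\<in>\<Lambda>. z \<noteq> w \<longrightarrow> \<delta> \<le> ph_dist z w)"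

definition uniformly_dense :: "complex set \<Rightarrow> bool" where
  "uniformly_dense \<Lambda> \<longleftrightarrow> \<Lambda> \<subseteq> unit_disc \<and> separated \<Lambda> \<and>
     (\<exists>r. 0 < r \<and> r < 1 \<and> unit_disc = (\<Union>z\<in>\<Lambda>. ph_disc z r))"

text \<open>Real-valued harmonic functions on an open subset of the plane: twice continuously
  differentiable with vanishing Laplacian. The witnesses are the first and second partial
  derivatives; all second partials are required to be continuous.\<close>

definition harmonic_on :: "(complex \<Rightarrow> real) \<Rightarrow> complex set \<Rightarrow> bool" where
  "harmonic_on u S \<longleftrightarrow>
     (\<exists>ux uy uxx uxy uyx uyy :: complex \<Rightarrow> real.
        (\<forall>z\<in>S. (u has_derivative (\<lambda>h. ux z * Re h + uy z * Im h)) (at z) \<and>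
               (ux has_derivative (\<lambda>h. uxx z * Re h + uxy z * Im h)) (at z) \<and>
               (uy has_derivative (\<lambda>h. uyx z * Re h + uyy z * Im h)) (at z) \<and>
               uxx z + uyy z = 0) \<and>
        continuous_on S uxx \<and> continuous_on S uxy \<and>
        continuous_on S uyx \<and> continuous_on S uyy)"

definition Har_plus :: "(complex \<Rightarrow> real) set" where
  "Har_plus = {h. harmonic_on h unit_disc \<and> (\<forall>z\<in>unit_disc. 0 \<le> h z)}"

text \<open>Since \<open>ln 0 = 0\<close> in the library, this also takes the correct value \<open>0\<close> at \<open>0\<close>.\<close>

definition log_plus :: "real \<Rightarrow> real" where
  "log_plus x = max 0 (ln x)"

definition nevanlinna :: "(complex \<Rightarrow> complex) set" where
  "nevanlinna = {f. f holomorphic_on unit_disc \<and>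
     (\<exists>L::real. ((\<lambda>r. 1 / (2 * pi) *
         integral {0..2 * pi} (\<lambda>\<theta>. log_plus (norm (f (of_real r * exp (\<i> * of_real \<theta>))))))
       \<longlongrightarrow> L) (at_left 1))}"

text \<open>The infimum is taken in the extended reals, so that an empty infimum would be \<open>\<infinity>\<close>.\<close>

definition Nev_on :: "(complex \<Rightarrow> complex) \<Rightarrow> complex set \<Rightarrow> ereal" where
  "Nev_on f E = Inf {ereal (h 0) | h. h \<in> Har_plus \<and> (\<forall>z\<in>E. ln (1 + norm (f z)) \<le> h z)}"

definition Nev :: "(complex \<Rightarrow> complex) \<Rightarrow> ereal" where
  "Nev f = Nev_on f unit_disc"

definition sampling_nevanlinna :: "complex set \<Rightarrow> bool" where
  "sampling_nevanlinna E \<longleftrightarrow>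
     (\<exists>C::real. C > 0 \<and> (\<forall>f\<in>nevanlinna. Nev f \<le> Nev_on f E + ereal C))"

definition disc_union :: "complex set \<Rightarrow> (real \<Rightarrow> real) \<Rightarrow> complex set" where
  "disc_union \<Lambda> \<phi> = (\<Union>z\<in>\<Lambda>. ph_disc z (\<phi> (1 - norm z)))"

end

theory Submission
  imports Defs
begin

text \<open>Put \<open>E = disc_union \<Lambda> \<phi>\<close>. The integral is compared with the series of
\<open>1 / ln (1 / \<phi> (q ^ m))\<close> for a fixed ratio \<open>q\<close>: the \<open>m\<close>-th term belongs to the points at
distance about \<open>q ^ m\<close> from the circle.

If the series diverges, then every inequality \<open>ln (1 + \<bar>f\<bar>) \<le> h\<close> on \<open>E\<close>, with \<open>f\<close> in the
Nevanlinna class and \<open>h\<close> a nonnegative harmonic function, extends to the whole disc. The difference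
\<open>u = ln (1 + \<bar>f\<bar>) - h\<close> is subharmonic, nonpositive on the small discs \<open>D(\<lambda>, \<phi>)\<close>, and bounded above
by any harmonic majorant \<open>Q \<ge> 0\<close> of \<open>ln (1 + \<bar>f\<bar>)\<close>. Suppose that \<open>u \<le> \<theta> Q\<close> on a
large disc about \<open>\<lambda>\<close>. In the annulus between the small disc and a large one, the maximum principle
compares \<open>u\<close> with \<open>\<theta> Q\<close> minus a multiple of the logarithm of the distance to \<open>\<lambda>\<close>, and Harnack's
inequality for \<open>Q\<close> turns this into
\<open>u \<le> \<theta> exp (- c / ln (1 / \<phi>)) Q\<close> on \<open>D(\<lambda>, r0)\<close> (\<open>annulus_decay\<close>). The discs \<open>D(\<lambda>, r0)\<close> cover the
unit disc, and passing to a large disc about \<open>\<lambda>\<close> costs only a constant factor in the distance to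
the circle. So the gain is available once per level, and all these gains multiply
(\<open>iterated_decay\<close>). Membership in the Nevanlinna class supplies, on each concentric disc, a
majorant \<open>Q\<close> whose value at \<open>0\<close> stays bounded; divergence of the series then forces \<open>u \<le> 0\<close>
(\<open>subharmonic_nonpos_of_dense_discs\<close>).

If the series converges, let \<open>w = (1 + z) / (1 - z)\<close>, so that \<open>Re w\<close> is the Poisson kernel
at the boundary point \<open>1\<close>, and take \<open>f = B exp (M w)\<close>. Here \<open>B\<close> is a Blaschke product with a zero of
order about \<open>K M Re w(\<lambda>) / ln (1 / \<phi>(1 - \<bar>\<lambda>\<bar>))\<close> at each \<open>\<lambda>\<close> with \<open>M Re w(\<lambda>) \<ge> 1\<close>. On
\<open>D(\<lambda>, \<phi>)\<close> such a zero makes \<open>B\<close> small enough to cancel the exponential, while at the remaining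
\<open>\<lambda>\<close> the exponential is bounded anyway; so \<open>N(f|E)\<close> is bounded independently of \<open>M\<close>. In
the half-plane of \<open>w\<close> a separated set puts at most one point into each cell of a fine geometric grid, and
summation over the cells shows that the orders satisfy the Blaschke condition because the
series converges (\<open>blaschke_weights_bounded\<close>). The same bound keeps \<open>\<bar>B\<bar>\<close> above
\<open>exp (- x / 2)\<close> at some point of the radius with \<open>w = x\<close>, where Harnack's inequality gives
\<open>h 0 \<ge> M - 1 / 2\<close> for each harmonic majorant \<open>h\<close> of \<open>ln (1 + \<bar>f\<bar>)\<close>. Large \<open>M\<close> contradicts sampling.\<close>

section \<open>Harmonic functions as real parts\<close>

text \<open>The mean value theorem, applied first in the horizontal and then in the vertical direction, expresses
the second difference over a square by one mixed partial derivative. Exchanging the directions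
expresses the same difference by the other one, whence they agree in the limit.\<close>

lemma mixed_difference_mean_value:
  fixes u ux uxy :: "complex \<Rightarrow> real" and s :: real
  assumes s: "s > 0"
    and sub: "\<And>a b. a \<in> {0..s} \<Longrightarrow> b \<in> {0..s} \<Longrightarrow> z + Complex a b \<in> S"
    and u: "\<And>w. w \<in> S \<Longrightarrow> (u has_derivative (\<lambda>h. ux w * Re h + uy w * Im h)) (at w)"
    and ux: "\<And>w. w \<in> S \<Longrightarrow> (ux has_derivative (\<lambda>h. uxx w * Re h + uxy w * Im h)) (at w)"
  obtains a b where "a \<in> {0..s}" "b \<in> {0..s}"
    "u (z + Complex s s) - u (z + Complex s 0) - (u (z + Complex 0 s) - u z) = s * s * uxy (z + Complex a b)"
proof -
  define g where "g = (\<lambda>a. u (z + Complex a s) - u (z + Complex a 0))"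
  have lin: "((\<lambda>a. z + Complex a b) has_derivative (\<lambda>h. Complex h 0)) (at a)"
    "((\<lambda>b. z + Complex a b) has_derivative (\<lambda>h. Complex 0 h)) (at b)" for a b
    unfolding Complex_eq by (auto intro!: derivative_eq_intros)
  have du: "((\<lambda>a. u (z + Complex a b)) has_real_derivative ux (z + Complex a b)) (at a)"
    if "a \<in> {0..s}" "b \<in> {0..s}" for a b
    using has_derivative_compose[OF lin(1) u[OF sub[OF that]]]
    by (simp add: has_field_derivative_def mult.commute[of _ "ux _"] mult_commute_abs)
  have dux: "((\<lambda>b. ux (z + Complex a b)) has_real_derivative uxy (z + Complex a b)) (at b)"
    if "a \<in> {0..s}" "b \<in> {0..s}" for a b
    using has_derivative_compose[OF lin(2) ux[OF sub[OF that]]]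
    by (simp add: has_field_derivative_def mult_commute_abs)
  obtain a where a: "0 < a" "a < s"
    "g s - g 0 = (s - 0) * (ux (z + Complex a s) - ux (z + Complex a 0))"
    using MVT2[OF s(1), of g "\<lambda>a. ux (z + Complex a s) - ux (z + Complex a 0)"] s
    unfolding g_def by (force intro!: DERIV_diff du)
  obtain b where b: "0 < b" "b < s"
    "ux (z + Complex a s) - ux (z + Complex a 0) = (s - 0) * uxy (z + Complex a b)"
    using MVT2[of 0 s "\<lambda>b. ux (z + Complex a b)" "\<lambda>b. uxy (z + Complex a b)"] s a
    by (force intro!: dux)
  show thesis
    using a b that[of a b] by (simp add: g_def Complex_eq)
qed

lemma mixed_partials_commute:
  fixes u ux uy uxx uxy uyx uyy :: "complex \<Rightarrow> real"
  assumes "open S" "z \<in> S"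
    and u: "\<And>w. w \<in> S \<Longrightarrow> (u has_derivative (\<lambda>h. ux w * Re h + uy w * Im h)) (at w)"
    and ux: "\<And>w. w \<in> S \<Longrightarrow> (ux has_derivative (\<lambda>h. uxx w * Re h + uxy w * Im h)) (at w)"
    and uy: "\<And>w. w \<in> S \<Longrightarrow> (uy has_derivative (\<lambda>h. uyx w * Re h + uyy w * Im h)) (at w)"
    and cont: "continuous_on S uxy" "continuous_on S uyx"
  shows "uxy z = uyx z"
proof -
  \<comment> \<open>Each mixed partial is within \<open>e\<close> of the common second difference quotient of a small square.\<close>
  have "\<bar>uxy z - uyx z\<bar> \<le> 2 * e" if "e > 0" for e
  proof -
    from cont \<open>open S\<close> \<open>z \<in> S\<close> have "isCont uxy z" "isCont uyx z"
      by (simp_all add: continuous_on_eq_continuous_at)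
    then obtain d1 d2 where d: "d1 > 0" "d2 > 0"
      "\<And>w. dist w z < d1 \<Longrightarrow> dist (uxy w) (uxy z) < e"
      "\<And>w. dist w z < d2 \<Longrightarrow> dist (uyx w) (uyx z) < e"
      using \<open>e > 0\<close> unfolding continuous_at_eps_delta by blast
    obtain d3 where d3: "d3 > 0" "ball z d3 \<subseteq> S"
      using \<open>open S\<close> \<open>z \<in> S\<close> open_contains_ball by blast
    define s where "s = Min {d1, d2, d3} / 3"
    have s: "s > 0" "3 * s \<le> d1" "3 * s \<le> d2" "3 * s \<le> d3"
      using d d3 by (auto simp: s_def)
    have near: "dist (z + Complex a b) z < 3 * s" if "a \<in> {0..s}" "b \<in> {0..s}" for a b
      using cmod_le[of "Complex a b"] that s by (auto simp: dist_norm)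
    have sub: "z + Complex a b \<in> S" if "a \<in> {0..s}" "b \<in> {0..s}" for a b
      using near[OF that] d3 s by (auto simp: dist_commute subset_eq)
    obtain a b where ab: "a \<in> {0..s}" "b \<in> {0..s}"
      "u (z + Complex s s) - u (z + Complex s 0) - (u (z + Complex 0 s) - u z) = s * s * uxy (z + Complex a b)"
      using mixed_difference_mean_value[OF s(1) sub u ux] by blast
    \<comment> \<open>The other mixed partial is reached by interchanging the two coordinates.\<close>
    define flip where "flip = (\<lambda>w. \<i> * cnj w)"
    have flip: "flip (flip w) = w" "Re (flip w) = Im w" "Im (flip w) = Re w" for w
      by (simp_all add: flip_def complex_eq_iff)
    have dflip: "(flip has_derivative flip) (at w)" for w
      unfolding flip_def by (auto intro!: derivative_eq_intros has_derivative_cnj)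
    have flip_add: "flip (flip z + Complex a b) = z + Complex b a" for a b
      by (simp add: flip_def complex_eq_iff)
    obtain a' b' where ab': "a' \<in> {0..s}" "b' \<in> {0..s}"
      "u (flip (flip z + Complex s s)) - u (flip (flip z + Complex s 0)) -
       (u (flip (flip z + Complex 0 s)) - u (flip (flip z))) = s * s * uyx (flip (flip z + Complex a' b'))"
    proof (rule mixed_difference_mean_value[of s "flip z" "flip -` S" "\<lambda>w. u (flip w)"
            "\<lambda>w. uy (flip w)" "\<lambda>w. ux (flip w)" "\<lambda>w. uyy (flip w)" "\<lambda>w. uyx (flip w)"])
      show "flip z + Complex a b \<in> flip -` S" if "a \<in> {0..s}" "b \<in> {0..s}" for a b
        using sub[OF that(2,1)] by (simp add: flip_add)
      show "((\<lambda>w. u (flip w)) has_derivative (\<lambda>h. uy (flip w) * Re h + ux (flip w) * Im h)) (at w)"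
        if "w \<in> flip -` S" for w
        using has_derivative_compose[OF dflip u] that by (simp add: flip add.commute)
      show "((\<lambda>w. uy (flip w)) has_derivative (\<lambda>h. uyy (flip w) * Re h + uyx (flip w) * Im h)) (at w)"
        if "w \<in> flip -` S" for w
        using has_derivative_compose[OF dflip uy] that by (simp add: flip add.commute)
    qed (use s(1) in auto)
    then have ab': "a' \<in> {0..s}" "b' \<in> {0..s}"
      "u (z + Complex s s) - u (z + Complex 0 s) - (u (z + Complex s 0) - u z) = s * s * uyx (z + Complex b' a')"
      unfolding flip_add flip by auto
    have "s * s * uxy (z + Complex a b) = s * s * uyx (z + Complex b' a')"
      using ab(3) ab'(3) by linarith
    then have "uxy (z + Complex a b) = uyx (z + Complex b' a')"
      using s(1) by simp
    with d(3)[of "z + Complex a b"] d(4)[of "z + Complex b' a'"]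
      near[OF ab(1,2)] near[OF ab'(2,1)] s show ?thesis
      by (auto simp: dist_real_def)
  qed
  then have "\<bar>uxy z - uyx z\<bar> \<le> 0 + e" if "e > 0" for e
    using that[THEN half_gt_zero] by fastforce
  then have "\<bar>uxy z - uyx z\<bar> \<le> 0"
    by (rule field_le_epsilon)
  then show ?thesis by simp
qed

text \<open>Harmonicity together with the equality of the mixed partials is the Cauchy-Riemann system for
\<open>ux - \<i> * uy\<close>. A primitive of this holomorphic function has real part \<open>u\<close> up to a constant.\<close>

lemma harmonic_on_ball_eq_Re:
  assumes "harmonic_on u (ball z0 R)"
  obtains F where "F holomorphic_on ball z0 R" "\<And>z. z \<in> ball z0 R \<Longrightarrow> u z = Re (F z)"
proof (cases "R > 0")
  case False
  then have empty: "ball z0 R = {}" by (rule ball_empty[OF leI])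
  show thesis
    by (rule that[of "\<lambda>_. 0"], rule holomorphic_on_const, unfold empty, erule emptyE)
next
  case True
  let ?S = "ball z0 R"
  obtain ux uy uxx uxy uyx uyy :: "complex \<Rightarrow> real" where
    *: "\<forall>w\<in>?S. (u has_derivative (\<lambda>h. ux w * Re h + uy w * Im h)) (at w) \<and>
      (ux has_derivative (\<lambda>h. uxx w * Re h + uxy w * Im h)) (at w) \<and>
      (uy has_derivative (\<lambda>h. uyx w * Re h + uyy w * Im h)) (at w) \<and> uxx w + uyy w = 0"
    and cont: "continuous_on ?S uxy" "continuous_on ?S uyx"
    using assms unfolding harmonic_on_def by (elim exE conjE) (rule that)
  note u = *[rule_format, THEN conjunct1]
    and ux = *[rule_format, THEN conjunct2, THEN conjunct1]
    and uy = *[rule_format, THEN conjunct2, THEN conjunct2, THEN conjunct1]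
    and lap = *[rule_format, THEN conjunct2, THEN conjunct2, THEN conjunct2]
  have comm: "uxy w = uyx w" if "w \<in> ?S" for w
    using mixed_partials_commute[OF open_ball that u ux uy cont] by blast
  define G where "G = (\<lambda>w. of_real (ux w) - \<i> * of_real (uy w))"
  have dG: "(G has_field_derivative (of_real (uxx w) - \<i> * of_real (uyx w))) (at w)"
    if w: "w \<in> ?S" for w
  proof -
    have "(G has_derivative (\<lambda>h. of_real (uxx w * Re h + uxy w * Im h)
            - \<i> * of_real (uyx w * Re h + uyy w * Im h))) (at w)"
      unfolding G_def
      by (intro has_derivative_diff has_derivative_mult_right has_derivative_of_real ux uy w)
    also have "(\<lambda>h. of_real (uxx w * Re h + uxy w * Im h)
            - \<i> * of_real (uyx w * Re h + uyy w * Im h)) =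
          (*) (of_real (uxx w) - \<i> * of_real (uyx w))"
      using lap[OF w] comm[OF w] by (auto simp: fun_eq_iff complex_eq_iff algebra_simps add_eq_0_iff)
    finally show ?thesis by (simp add: has_field_derivative_def)
  qed
  then have "G holomorphic_on ?S"
    unfolding holomorphic_on_open[OF open_ball] by blast
  then obtain F where F: "\<And>w. w \<in> ?S \<Longrightarrow> (F has_field_derivative G w) (at w within ?S)"
    using holomorphic_convex_primitive'[of ?S G] by auto
  have dF: "(F has_field_derivative G w) (at w)" if "w \<in> ?S" for w
    using F[OF that] that by (simp add: at_within_open[of _ ?S])
  have "((\<lambda>w. u w - Re (F w)) has_derivative (\<lambda>h. 0)) (at w within ?S)" if w: "w \<in> ?S" for w
  proof -
    have "((\<lambda>w. u w - Re (F w)) has_derivative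
            (\<lambda>h. ux w * Re h + uy w * Im h - Re (G w * h))) (at w)"
      using dF[OF w] unfolding has_field_derivative_def
      by (intro has_derivative_diff u w has_derivative_Re)
    also have "(\<lambda>h. ux w * Re h + uy w * Im h - Re (G w * h)) = (\<lambda>h. 0)"
      by (auto simp: G_def fun_eq_iff)
    finally show ?thesis
      by (rule has_derivative_at_withinI)
  qed
  then obtain c where c: "\<And>w. w \<in> ?S \<Longrightarrow> u w - Re (F w) = c"
    using has_derivative_zero_constant[of ?S "\<lambda>w. u w - Re (F w)"] by auto
  have hol: "(\<lambda>w. F w + of_real c) holomorphic_on ?S"
    unfolding holomorphic_on_open[OF open_ball]
    using DERIV_add[OF dF DERIV_const] by fastforce
  show thesis
    by (rule that[OF hol]) (use c in \<open>force simp: algebra_simps\<close>)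
qed

lemma Har_plusE:
  assumes "h \<in> Har_plus"
  obtains F where "F holomorphic_on ball 0 1" "\<And>z. norm z < 1 \<Longrightarrow> h z = Re (F z)"
    "\<And>z. norm z < 1 \<Longrightarrow> 0 \<le> h z"
proof -
  have "harmonic_on h (ball 0 1)" "\<And>z. norm z < 1 \<Longrightarrow> 0 \<le> h z"
    using assms by (auto simp: Har_plus_def)
  then show thesis
    using harmonic_on_ball_eq_Re[of h 0 1] that by (metis mem_ball_0)
qed

section \<open>Functions supported from below by real parts\<close>

text \<open>Subharmonicity through touching from below: near each point the function dominates the real part of a
holomorphic function that has the same value there. This covers \<open>ln (1 + \<bar>f\<bar>)\<close>, the positive part of
\<open>ln \<bar>f\<bar>\<close> and the multiples of \<open>ln \<bar>f\<bar>\<close> away from zeros. It passes to sums, and it yields the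
maximum principle from the maximum modulus theorem alone, without integral means.\<close>

definition support_subharmonic :: "(complex \<Rightarrow> real) \<Rightarrow> complex set \<Rightarrow> bool" where
  "support_subharmonic u S \<longleftrightarrow>
     (\<forall>z\<in>S. \<exists>r>0. \<exists>g. ball z r \<subseteq> S \<and> g holomorphic_on ball z r \<and> u z = Re (g z) \<and>
        (\<forall>w\<in>ball z r. Re (g w) \<le> u w))"

lemma support_subharmonicE:
  assumes "support_subharmonic u S" "z \<in> S"
  obtains r g where "r > 0" "ball z r \<subseteq> S" "g holomorphic_on ball z r" "u z = Re (g z)"
    "\<And>w. w \<in> ball z r \<Longrightarrow> Re (g w) \<le> u w"
  using assms unfolding support_subharmonic_def by metis

lemma support_subharmonicI:
  assumes "open S"
    and "\<And>z. z \<in> S \<Longrightarrow> \<exists>r>0. \<exists>g. g holomorphic_on ball z r \<and> u z = Re (g z) \<and>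
        (\<forall>w\<in>ball z r \<inter> S. Re (g w) \<le> u w)"
  shows "support_subharmonic u S"
  unfolding support_subharmonic_def
proof
  fix z assume z: "z \<in> S"
  obtain r g where rg: "r > 0" "g holomorphic_on ball z r" "u z = Re (g z)"
    "\<And>w. w \<in> ball z r \<inter> S \<Longrightarrow> Re (g w) \<le> u w"
    using assms(2)[OF z] by blast
  obtain e where e: "e > 0" "ball z e \<subseteq> S"
    using \<open>open S\<close> z open_contains_ball by blast
  have "ball z (min r e) \<subseteq> ball z r" "ball z (min r e) \<subseteq> S"
    using e by auto
  then show "\<exists>r>0. \<exists>g. ball z r \<subseteq> S \<and> g holomorphic_on ball z r \<and> u z = Re (g z) \<and>
        (\<forall>w\<in>ball z r. Re (g w) \<le> u w)"
    using rg e by (intro exI[of _ "min r e"] conjI exI[of _ g]) (auto intro: holomorphic_on_subset)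
qed

lemma support_subharmonic_subset:
  assumes "support_subharmonic u S" "open S'" "S' \<subseteq> S"
  shows "support_subharmonic u S'"
proof (rule support_subharmonicI[OF assms(2)])
  fix z assume "z \<in> S'"
  then obtain r g where "r > 0" "ball z r \<subseteq> S" "g holomorphic_on ball z r" "u z = Re (g z)"
    "\<And>w. w \<in> ball z r \<Longrightarrow> Re (g w) \<le> u w"
    using support_subharmonicE[OF assms(1)] assms(3) by blast
  then show "\<exists>r>0. \<exists>g. g holomorphic_on ball z r \<and> u z = Re (g z) \<and>
        (\<forall>w\<in>ball z r \<inter> S'. Re (g w) \<le> u w)"
    by blast
qed

lemma support_subharmonic_add:
  assumes "support_subharmonic u S" "support_subharmonic v S"
  shows "support_subharmonic (\<lambda>z. u z + v z) S"
  unfolding support_subharmonic_def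
proof
  fix z assume z: "z \<in> S"
  obtain r g where 1: "r > 0" "ball z r \<subseteq> S" "g holomorphic_on ball z r" "u z = Re (g z)"
    "\<And>w. w \<in> ball z r \<Longrightarrow> Re (g w) \<le> u w"
    using support_subharmonicE[OF assms(1) z] by blast
  obtain s h where 2: "s > 0" "ball z s \<subseteq> S" "h holomorphic_on ball z s" "v z = Re (h z)"
    "\<And>w. w \<in> ball z s \<Longrightarrow> Re (h w) \<le> v w"
    using support_subharmonicE[OF assms(2) z] by blast
  have sub: "ball z (min r s) \<subseteq> ball z r" "ball z (min r s) \<subseteq> ball z s" by auto
  show "\<exists>r>0. \<exists>g. ball z r \<subseteq> S \<and> g holomorphic_on ball z r \<and> u z + v z = Re (g z) \<and>
        (\<forall>w\<in>ball z r. Re (g w) \<le> u w + v w)"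
    using 1 2 sub
    by (intro exI[of _ "min r s"] conjI exI[of _ "\<lambda>z. g z + h z"])
      (auto intro!: holomorphic_intros add_mono intro: holomorphic_on_subset)
qed

lemma support_subharmonic_Re:
  assumes "open S" "F holomorphic_on S"
  shows "support_subharmonic (\<lambda>z. Re (F z)) S"
  unfolding support_subharmonic_def
proof
  fix z assume z: "z \<in> S"
  obtain e where e: "e > 0" "ball z e \<subseteq> S"
    using assms(1) z open_contains_ball by blast
  then show "\<exists>r>0. \<exists>g. ball z r \<subseteq> S \<and> g holomorphic_on ball z r \<and> Re (F z) = Re (g z) \<and>
        (\<forall>w\<in>ball z r. Re (g w) \<le> Re (F w))"
    using assms by (intro exI[of _ e] conjI exI[of _ F]) (auto intro: holomorphic_on_subset)
qed

lemma support_subharmonic_compose: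
  assumes "support_subharmonic u S" "open A" "m holomorphic_on A" "m ` A \<subseteq> S"
  shows "support_subharmonic (\<lambda>z. u (m z)) A"
proof (rule support_subharmonicI[OF assms(2)])
  fix z assume z: "z \<in> A"
  obtain r g where 1: "r > 0" "ball (m z) r \<subseteq> S" "g holomorphic_on ball (m z) r" "u (m z) = Re (g (m z))"
    "\<And>w. w \<in> ball (m z) r \<Longrightarrow> Re (g w) \<le> u w"
    using support_subharmonicE[OF assms(1)] z assms(4) by blast
  have "open (A \<inter> m -` ball (m z) r)"
    using assms(2,3) by (intro continuous_open_preimage holomorphic_on_imp_continuous_on) auto
  moreover have "z \<in> A \<inter> m -` ball (m z) r" using z 1 by auto
  ultimately obtain e where e: "e > 0" "ball z e \<subseteq> A \<inter> m -` ball (m z) r"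
    by (metis open_contains_ball)
  have "(g \<circ> m) holomorphic_on ball z e"
    by (rule holomorphic_on_compose_gen[OF holomorphic_on_subset[OF assms(3)] 1(3)])
      (use e in auto)
  then show "\<exists>r>0. \<exists>g. g holomorphic_on ball z r \<and> u (m z) = Re (g z) \<and>
              (\<forall>w\<in>ball z r \<inter> A. Re (g w) \<le> u (m w))"
    using e 1 by (intro exI[of _ e] conjI exI[of _ "g \<circ> m"]) auto
qed

lemma local_logarithm:
  assumes "open S" "f holomorphic_on S" "z \<in> S" "f z \<noteq> 0"
  obtains r g where "r > 0" "ball z r \<subseteq> S" "g holomorphic_on ball z r"
    "\<And>w. w \<in> ball z r \<Longrightarrow> Re (g w) = ln (norm (f w))" "\<And>w. w \<in> ball z r \<Longrightarrow> f w \<noteq> 0"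
proof -
  have "open (S \<inter> f -` ball (f z) (norm (f z)))"
    using assms by (intro continuous_open_preimage holomorphic_on_imp_continuous_on) auto
  moreover have "z \<in> S \<inter> f -` ball (f z) (norm (f z))" using assms by auto
  ultimately obtain r where r: "r > 0" "ball z r \<subseteq> S \<inter> f -` ball (f z) (norm (f z))"
    by (metis open_contains_ball)
  have nz: "f w \<noteq> 0" if "w \<in> ball z r" for w
    using r that by auto
  have pos: "f w / f z \<notin> \<real>\<^sub>\<le>\<^sub>0" if "w \<in> ball z r" for w
  proof -
    have "norm (f w / f z - 1) < 1"
      using r that assms(4) by (auto simp: dist_norm norm_minus_commute field_simps norm_divide
          diff_divide_eq_iff subset_iff)
    then have "Re (f w / f z) > 0"
      using abs_Re_le_cmod[of "f w / f z - 1"] by (simp add: abs_le_iff)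
    then show ?thesis by (auto elim: nonpos_Reals_cases simp: complex_nonpos_Reals_iff)
  qed
  define g where "g = (\<lambda>w. Ln (f w / f z) + of_real (ln (norm (f z))))"
  have "f holomorphic_on ball z r"
    using assms r by (auto intro: holomorphic_on_subset)
  then have "g holomorphic_on ball z r"
    unfolding g_def using pos assms(4) by (intro holomorphic_intros) auto
  moreover have "Re (g w) = ln (norm (f w))" if "w \<in> ball z r" for w
    using nz[OF that] assms(4) by (simp add: g_def norm_divide ln_div)
  ultimately show thesis
    using r nz by (intro that[of r g]) auto
qed

text \<open>\<open>ln (1 + \<bar>f\<bar>)\<close> is the supremum of the functions \<open>ln \<bar>1 + c * f\<bar>\<close> over \<open>\<bar>c\<bar> \<le> 1\<close>; the supremum is
attained at \<open>z\<close> by the \<open>c\<close> that rotates \<open>f z\<close> onto the positive axis, and there the logarithm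
is real part of a holomorphic function.\<close>

lemma support_subharmonic_ln_one_plus_norm:
  assumes "open S" "f holomorphic_on S"
  shows "support_subharmonic (\<lambda>z. ln (1 + norm (f z))) S"
proof (rule support_subharmonicI[OF assms(1)])
  fix z assume z: "z \<in> S"
  define c where "c = (if f z = 0 then 0 else of_real (norm (f z)) / f z)"
  have c: "norm c \<le> 1" "1 + c * f z = of_real (1 + norm (f z))"
    by (auto simp: c_def norm_divide)
  have nz: "1 + c * f z \<noteq> 0"
    unfolding c(2) of_real_eq_0_iff using norm_ge_zero[of "f z"] by linarith
  have "(\<lambda>w. 1 + c * f w) holomorphic_on S"
    using assms(2) by (intro holomorphic_intros)
  then obtain r g where r: "r > 0" "ball z r \<subseteq> S" "g holomorphic_on ball z r"
    "\<And>w. w \<in> ball z r \<Longrightarrow> Re (g w) = ln (norm (1 + c * f w))"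
    "\<And>w. w \<in> ball z r \<Longrightarrow> 1 + c * f w \<noteq> 0"
    using local_logarithm[where f = "\<lambda>w. 1 + c * f w", OF assms(1) _ z nz] by metis
  have "Re (g w) \<le> ln (1 + norm (f w))" if "w \<in> ball z r" for w
  proof -
    have "norm (1 + c * f w) \<le> 1 + norm c * norm (f w)"
      by (metis norm_mult norm_one norm_triangle_ineq)
    also have "\<dots> \<le> 1 + norm (f w)"
      using c(1) by (simp add: mult_left_le_one_le)
    finally show ?thesis
      unfolding r(4)[OF that] using r(5)[OF that] by (intro ln_mono) auto
  qed
  moreover have "ln (1 + norm (f z)) = Re (g z)"
  proof -
    have "norm (1 + c * f z) = 1 + norm (f z)"
      unfolding c(2) norm_of_real by simp
    then show ?thesis using r(1,4) by simp
  qed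
  ultimately show "\<exists>r>0. \<exists>g. g holomorphic_on ball z r \<and> ln (1 + norm (f z)) = Re (g z) \<and>
              (\<forall>w\<in>ball z r \<inter> S. Re (g w) \<le> ln (1 + norm (f w)))"
    using r by blast
qed

lemma support_subharmonic_log_plus_norm:
  assumes "open S" "f holomorphic_on S"
  shows "support_subharmonic (\<lambda>z. log_plus (norm (f z))) S"
proof (rule support_subharmonicI[OF assms(1)])
  fix z assume z: "z \<in> S"
  show "\<exists>r>0. \<exists>g. g holomorphic_on ball z r \<and> log_plus (norm (f z)) = Re (g z) \<and>
              (\<forall>w\<in>ball z r \<inter> S. Re (g w) \<le> log_plus (norm (f w)))"
  proof (cases "ln (norm (f z)) \<le> 0")
    case True
    then show ?thesis
      by (intro exI[of _ 1] conjI exI[of _ "\<lambda>_. 0"]) (auto simp: log_plus_def)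
  next
    case False
    then have "f z \<noteq> 0" by auto
    then obtain r g where r: "r > 0" "ball z r \<subseteq> S" "g holomorphic_on ball z r"
      "\<And>w. w \<in> ball z r \<Longrightarrow> Re (g w) = ln (norm (f w))"
      using local_logarithm[OF assms z] by metis
    then show ?thesis using False
      by (intro exI[of _ r] conjI exI[of _ g]) (auto simp: log_plus_def)
  qed
qed

lemma support_subharmonic_ln_norm:
  assumes "open S" "f holomorphic_on S" "\<And>z. z \<in> S \<Longrightarrow> f z \<noteq> 0"
  shows "support_subharmonic (\<lambda>z. c * ln (norm (f z))) S"
proof (rule support_subharmonicI[OF assms(1)])
  fix z assume z: "z \<in> S"
  obtain r g where r: "r > 0" "ball z r \<subseteq> S" "g holomorphic_on ball z r"
    "\<And>w. w \<in> ball z r \<Longrightarrow> Re (g w) = ln (norm (f w))"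
    using local_logarithm[OF assms(1,2) z assms(3)[OF z]] by metis
  then show "\<exists>r>0. \<exists>g. g holomorphic_on ball z r \<and> c * ln (norm (f z)) = Re (g z) \<and>
              (\<forall>w\<in>ball z r \<inter> S. Re (g w) \<le> c * ln (norm (f w)))"
    by (intro exI[of _ r] conjI exI[of _ "\<lambda>w. of_real c * g w"]) (auto intro!: holomorphic_intros)
qed

text \<open>At a point where the maximum is attained, the supporting real part is constant by the maximum modulus
theorem, so the maximum is attained on a whole ball. The rightmost maximum point contradicts this.\<close>

lemma support_subharmonic_max_principle:
  assumes u: "support_subharmonic u S" and "open S" "bounded S"
    and cont: "continuous_on (closure S) u"
    and bd: "\<And>z. z \<in> frontier S \<Longrightarrow> u z \<le> 0"
    and "z \<in> closure S"
  shows "u z \<le> 0"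
proof (rule ccontr)
  assume pos: "\<not> u z \<le> 0"
  have cpt: "compact (closure S)"
    using \<open>bounded S\<close> by (simp add: compact_closure)
  have ne: "closure S \<noteq> {}" using \<open>z \<in> closure S\<close> by auto
  obtain x where x: "x \<in> closure S" "\<forall>y\<in>closure S. u y \<le> u x"
    using continuous_attains_sup[OF cpt ne cont] by blast
  note x = x(1) x(2)[rule_format]
  have "u x > 0" using x(2)[OF \<open>z \<in> closure S\<close>] pos by linarith
  define K where "K = {y \<in> closure S. u y = u x}"
  have "K \<subseteq> S"
  proof
    fix y assume y: "y \<in> K"
    then have "y \<notin> frontier S" using bd \<open>u x > 0\<close> by (fastforce simp: K_def)
    then show "y \<in> S" using y \<open>open S\<close> by (auto simp: K_def frontier_def interior_open)
  qed
  have "closed K"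
    unfolding K_def using continuous_closed_preimage_constant[OF cont closed_closure] by simp
  then have "compact K"
    using cpt by (metis (no_types, lifting) K_def compact_Int_closed inf.absorb_iff2 mem_Collect_eq subsetI)
  moreover have "x \<in> K" using x by (auto simp: K_def)
  \<comment> \<open>The set of maximum points is compact, so it has a rightmost point.\<close>
  ultimately obtain a where a: "a \<in> K" "\<forall>y\<in>K. Re y \<le> Re a"
    using continuous_attains_sup[of K Re] linear_continuous_on[OF bounded_linear_Re] by blast
  note a = a(1) a(2)[rule_format]
  then have "a \<in> S" using \<open>K \<subseteq> S\<close> by auto
  obtain r g where rg: "r > 0" "ball a r \<subseteq> S" "g holomorphic_on ball a r" "u a = Re (g a)"
    "\<And>w. w \<in> ball a r \<Longrightarrow> Re (g w) \<le> u w"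
    using support_subharmonicE[OF u \<open>a \<in> S\<close>] by blast
  have le: "Re (g w) \<le> Re (g a)" if "w \<in> ball a r" for w
  proof -
    have "w \<in> closure S" using that rg(2) closure_subset by blast
    then show ?thesis
      using rg(5)[OF that] x(2)[of w] rg(4) a(1) by (simp add: K_def)
  qed
  have "(\<lambda>w. exp (g w)) constant_on ball a r"
    by (rule maximum_modulus_principle[of _ _ "ball a r" a])
      (use rg le in \<open>auto intro!: holomorphic_intros\<close>)
  then have const: "exp (g w) = exp (g a)" if "w \<in> ball a r" for w
    using that rg(1) unfolding constant_on_def by (metis centre_in_ball)
  define b where "b = a + of_real (r / 2)"
  have b: "b \<in> ball a r" using rg(1) by (simp add: b_def dist_norm)
  have "Re (g b) = Re (g a)"
    using const[OF b] by (metis norm_exp_eq_Re exp_inj_iff)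
  then have "u b \<ge> u x"
    using rg(4) rg(5)[OF b] a(1) by (simp add: K_def)
  moreover have "b \<in> closure S" using b rg(2) closure_subset by blast
  ultimately have "b \<in> K" using x(2)[of b] by (simp add: K_def)
  then show False using a(2)[of b] rg(1) by (simp add: b_def)
qed

section \<open>Harnack's inequality and harmonic majorants\<close>

text \<open>The map \<open>\<zeta> \<mapsto> (\<zeta> - p 0) / (\<zeta> + cnj (p 0))\<close> takes the right half-plane to the unit disc and \<open>p 0\<close> to
\<open>0\<close>, so the Schwarz lemma bounds \<open>p z\<close>. To have \<open>Re (p 0) > 0\<close>, a positive constant is
added to \<open>p\<close> and removed at the end.\<close>

lemma Harnack_at_centre:
  assumes p: "p holomorphic_on ball 0 1" and pos: "\<And>z. norm z < 1 \<Longrightarrow> Re (p z) \<ge> 0"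
    and z: "norm z < 1"
  shows "(1 - norm z) / (1 + norm z) * Re (p 0) \<le> Re (p z)"
    and "Re (p z) \<le> (1 + norm z) / (1 - norm z) * Re (p 0)"
proof -
  have main: "(1 - norm z) / (1 + norm z) * (Re (p 0) + e) \<le> Re (p z) + e \<and>
       Re (p z) + e \<le> (1 + norm z) / (1 - norm z) * (Re (p 0) + e)" if e: "e > 0" for e
  proof -
    define P where "P = (\<lambda>z. p z + of_real e)"
    have Ppos: "Re (P w) > 0" if "norm w < 1" for w
      using pos[OF that] e by (simp add: P_def)
    define c where "c = P 0"
    have c: "Re c > 0" using Ppos[of 0] by (simp add: c_def)
    define q where "q = (\<lambda>w. (P w - c) / (P w + cnj c))"
    have nz: "P w + cnj c \<noteq> 0" if "norm w < 1" for w
      using Ppos[OF that] c by (auto simp: complex_eq_iff)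
    have "q holomorphic_on ball 0 1"
      unfolding q_def P_def using p nz by (intro holomorphic_intros) (auto simp: P_def)
    moreover have "q 0 = 0" by (simp add: q_def c_def)
    moreover have "norm (q w) < 1" if "norm w < 1" for w
    proof -
      have "norm (P w - c)^2 < norm (P w + cnj c)^2"
        using mult_pos_pos[OF Ppos[OF that] c] unfolding cmod_power2
        by (simp add: power2_eq_square algebra_simps)
      then have "norm (P w - c) < norm (P w + cnj c)"
        by (rule power_less_imp_less_base) simp
      then show ?thesis using nz[OF that] by (simp add: q_def norm_divide)
    qed
    ultimately have q: "norm (q z) \<le> norm z"
      using Schwarz_Lemma(1)[OF _ _ _ z] by blast
    have q1: "q z \<noteq> 1" using q z by auto
    have "q z * (P z + cnj c) = P z - c"
      using nz[OF z] by (simp add: q_def)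
    then have "P z * (1 - q z) = c + cnj c * q z"
      by (simp add: algebra_simps)
    then have Pz: "P z = (c + cnj c * q z) / (1 - q z)"
      using q1 by (simp add: field_simps)
    have Re: "Re (P z) = Re c * (1 - norm (q z)^2) / norm (1 - q z)^2"
    proof -
      have "Re (P z) = Re ((c + cnj c * q z) * cnj (1 - q z)) / norm (1 - q z)^2"
        unfolding Pz by (subst complex_div_cnj) (simp flip: of_real_power)
      also have "Re ((c + cnj c * q z) * cnj (1 - q z)) = Re c * (1 - norm (q z)^2)"
        unfolding cmod_power2 by (simp add: power2_eq_square algebra_simps)
      finally show ?thesis .
    qed
    define t where "t = norm (q z)"
    have t: "0 \<le> t" "t \<le> norm z" "t < 1" using q z by (auto simp: t_def)
    have lo: "1 - t \<le> norm (1 - q z)" and hi: "norm (1 - q z) \<le> 1 + t"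
      unfolding t_def using norm_triangle_ineq2[of 1 "q z"] norm_triangle_ineq4[of 1 "q z"] by auto
    have eq: "1 - t^2 = (1 - t) * (1 + t)" by (simp add: power2_eq_square algebra_simps)
    have "(1 - norm z) / (1 + norm z) \<le> (1 - t) / (1 + t)"
      using t z by (auto simp: field_simps)
    also have "\<dots> = (1 - t^2) / (1 + t)^2"
      unfolding eq using t by (simp add: power2_eq_square)
    also have "\<dots> \<le> (1 - t^2) / norm (1 - q z)^2"
      using hi lo t by (intro divide_left_mono power_mono mult_pos_pos zero_less_power)
        (auto simp: abs_square_le_1)
    finally have 1: "(1 - norm z) / (1 + norm z) * Re c \<le> Re (P z)"
      unfolding Re t_def using c by (simp add: mult.commute[of "Re c"] mult_right_mono times_divide_eq_left[symmetric] del: times_divide_eq_left)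
    have "(1 - t^2) / norm (1 - q z)^2 \<le> (1 - t^2) / (1 - t)^2"
      using hi lo t by (intro divide_left_mono power_mono mult_pos_pos zero_less_power)
        (auto simp: abs_square_le_1)
    also have "\<dots> = (1 + t) / (1 - t)"
      unfolding eq using t by (simp add: power2_eq_square)
    also have "\<dots> \<le> (1 + norm z) / (1 - norm z)"
      using t z by (auto simp: field_simps)
    finally have 2: "Re (P z) \<le> (1 + norm z) / (1 - norm z) * Re c"
      unfolding Re t_def using c by (simp add: mult.commute[of "Re c"] mult_right_mono times_divide_eq_left[symmetric] del: times_divide_eq_left)
    show ?thesis using 1 2 by (simp add: P_def c_def)
  qed
  define a where "a = (1 - norm z) / (1 + norm z)"
  define b where "b = (1 + norm z) / (1 - norm z)"
  have ab: "0 \<le> a" "0 < b"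
    using z by (auto simp: a_def b_def intro!: divide_pos_pos add_pos_nonneg)
  show "a * Re (p 0) \<le> Re (p z)"
  proof (rule field_le_epsilon)
    fix e :: real assume "e > 0"
    from main[OF this] have "a * Re (p 0) + a * e \<le> Re (p z) + e"
      by (simp add: a_def distrib_left)
    moreover have "a * e \<ge> 0" using ab \<open>e > 0\<close> by simp
    ultimately show "a * Re (p 0) \<le> Re (p z) + e" by linarith
  qed
  show "Re (p z) \<le> b * Re (p 0)"
  proof (rule field_le_epsilon)
    fix e :: real assume e: "e > 0"
    then have "Re (p z) + e / b \<le> b * (Re (p 0) + e / b)"
      using main[OF divide_pos_pos[OF e ab(2)]] unfolding b_def by blast
    also have "\<dots> = b * Re (p 0) + e" using ab by (simp add: distrib_left)
    finally show "Re (p z) \<le> b * Re (p 0) + e"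
      using e ab by (smt (verit) divide_nonneg_pos)
  qed
qed

lemma Harnack_ball:
  assumes p: "p holomorphic_on ball 0 R" and pos: "\<And>z. norm z < R \<Longrightarrow> Re (p z) \<ge> 0"
    and "R > 0" and z: "norm z < R"
  shows "(R - norm z) / (R + norm z) * Re (p 0) \<le> Re (p z)"
    and "Re (p z) \<le> (R + norm z) / (R - norm z) * Re (p 0)"
proof -
  have hol: "(\<lambda>w. p (of_real R * w)) holomorphic_on ball 0 1"
    using \<open>R > 0\<close>
    by (intro holomorphic_on_compose_gen[OF _ p, unfolded o_def] holomorphic_intros)
      (auto simp: norm_mult)
  have eq: "1 - norm (z / of_real R) = (R - norm z) / R" "1 + norm (z / of_real R) = (R + norm z) / R"
    using \<open>R > 0\<close> by (auto simp: norm_divide field_simps)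
  note * = Harnack_at_centre[OF hol, of "z / of_real R", unfolded eq]
  show "(R - norm z) / (R + norm z) * Re (p 0) \<le> Re (p z)"
    and "Re (p z) \<le> (R + norm z) / (R - norm z) * Re (p 0)"
    using * pos \<open>R > 0\<close> z by (simp_all add: norm_mult norm_divide)
qed

text \<open>The real parts of complex polynomials, generated by monomials so that statements about products reduce
to products of two monomials.\<close>

inductive Re_polynomial :: "(complex \<Rightarrow> real) \<Rightarrow> bool" where
  mono: "Re_polynomial (\<lambda>z. Re (a * z ^ k))"
| add: "Re_polynomial f \<Longrightarrow> Re_polynomial g \<Longrightarrow> Re_polynomial (\<lambda>z. f z + g z)"

lemma Re_polynomial_entire:
  assumes "Re_polynomial f"
  obtains p where "p holomorphic_on UNIV" "\<And>z. f z = Re (p z)"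
  using assms
proof (induction arbitrary: thesis)
  case (mono a k)
  show ?case by (rule mono[of "\<lambda>z. a * z ^ k"]) (auto intro!: holomorphic_intros)
next
  case (add f g)
  obtain p where p: "p holomorphic_on UNIV" "\<And>z. f z = Re (p z)" using add.IH(1) by blast
  obtain q where q: "q holomorphic_on UNIV" "\<And>z. g z = Re (q z)" using add.IH(2) by blast
  show ?case by (rule add.prems[of "\<lambda>z. p z + q z"]) (use p q in \<open>auto intro!: holomorphic_intros\<close>)
qed

text \<open>On the circle of radius \<open>r\<close> one has \<open>cnj z * z = r\<^sup>2\<close>. So in the product of two real parts the
mixed term with \<open>cnj z ^ j * z ^ k\<close> is again a monomial in \<open>z\<close>, which is why the restrictions of real
parts of polynomials form an algebra.\<close>

lemma monomial_mult_on_sphere_le: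
  assumes "j \<le> k"
  shows "\<exists>h. Re_polynomial h \<and> (\<forall>z\<in>sphere 0 r. Re (a * z ^ j) * Re (b * z ^ k) = h z)"
proof -
  define c where "c = cnj a * b * of_real (r ^ (2 * j)) / 2"
  have "Re (a * z ^ j) * Re (b * z ^ k) = Re (a * b / 2 * z ^ (j + k)) + Re (c * z ^ (k - j))"
    if "z \<in> sphere 0 r" for z
  proof -
    have "cnj (z ^ j) * z ^ k = (z * cnj z) ^ j * z ^ (k - j)"
      using assms by (simp add: power_mult_distrib flip: power_add mult.assoc)
    also have "z * cnj z = of_real (r ^ 2)"
      using that by (simp add: complex_norm_square[symmetric])
    finally have *: "cnj (z ^ j) * z ^ k = of_real (r ^ (2 * j)) * z ^ (k - j)"
      by (simp add: power_mult)
    have polarize: "Re x * Re y = Re (x * y / 2) + Re (cnj x * y / 2)" for x y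
      by (simp add: field_simps)
    have "Re (a * z ^ j) * Re (b * z ^ k) =
        Re ((a * z ^ j) * (b * z ^ k) / 2) + Re (cnj (a * z ^ j) * (b * z ^ k) / 2)"
      by (rule polarize)
    also have "(a * z ^ j) * (b * z ^ k) / 2 = a * b / 2 * z ^ (j + k)"
      by (simp add: power_add mult_ac)
    also have "cnj (a * z ^ j) * (b * z ^ k) / 2 = cnj a * b / 2 * (cnj (z ^ j) * z ^ k)"
      by simp
    also have "\<dots> = c * z ^ (k - j)"
      unfolding * c_def by simp
    finally show ?thesis .
  qed
  then show ?thesis
    by (intro exI[of _ "\<lambda>z. Re (a * b / 2 * z ^ (j + k)) + Re (c * z ^ (k - j))"] conjI)
      (rule Re_polynomial.add Re_polynomial.mono | blast)+
qed

lemma monomial_mult_on_sphere: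
  "\<exists>h. Re_polynomial h \<and> (\<forall>z\<in>sphere 0 r. Re (a * z ^ j) * Re (b * z ^ k) = h z)"
proof (cases "j \<le> k")
  case True
  then show ?thesis by (rule monomial_mult_on_sphere_le)
next
  case False
  then show ?thesis
    using monomial_mult_on_sphere_le[of k j r b a] by (simp add: mult.commute)
qed

lemma Re_polynomial_mult_on_sphere:
  assumes "Re_polynomial f" "Re_polynomial g"
  shows "\<exists>h. Re_polynomial h \<and> (\<forall>z\<in>sphere 0 r. f z * g z = h z)"
  using assms
proof (induction arbitrary: g)
  case (mono a j)
  from mono show ?case
  proof (induction)
    case (mono b k)
    show ?case by (rule monomial_mult_on_sphere)
  next
    case (add f g)
    then obtain h1 h2 where
      "Re_polynomial h1" "\<forall>z\<in>sphere 0 r. Re (a * z ^ j) * f z = h1 z"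
      "Re_polynomial h2" "\<forall>z\<in>sphere 0 r. Re (a * z ^ j) * g z = h2 z" by blast
    then show ?case
      by (intro exI[of _ "\<lambda>z. h1 z + h2 z"]) (auto intro: Re_polynomial.add simp: distrib_left)
  qed
next
  case (add f1 f2)
  then obtain h1 h2 where
    "Re_polynomial h1" "\<forall>z\<in>sphere 0 r. f1 z * g z = h1 z"
    "Re_polynomial h2" "\<forall>z\<in>sphere 0 r. f2 z * g z = h2 z" by metis
  then show ?case
    by (intro exI[of _ "\<lambda>z. h1 z + h2 z"]) (auto intro: Re_polynomial.add simp: distrib_right)
qed

text \<open>The Dirichlet problem on a disc in approximate form: by the Stone-Weierstrass theorem, continuous
boundary values are nearly those of the real part of a polynomial. It takes the place of the Poisson
integral.\<close>

lemma continuous_on_sphere_approx_Re_entire: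
  fixes u :: "complex \<Rightarrow> real"
  assumes "continuous_on (sphere 0 r) u" "e > 0"
  obtains p where "p holomorphic_on UNIV" "\<And>z. z \<in> sphere 0 r \<Longrightarrow> \<bar>u z - Re (p z)\<bar> < e"
proof -
  define P where "P = (\<lambda>f. \<exists>h. Re_polynomial h \<and> (\<forall>z\<in>sphere 0 r. f z = h z))"
  have "\<exists>g. P g \<and> (\<forall>x\<in>sphere 0 r. \<bar>u x - g x\<bar> < e)"
  proof (rule Stone_Weierstrass_HOL)
    show "compact (sphere (0::complex) r)" by simp
    show "P (\<lambda>x. c)" for c
      unfolding P_def by (intro exI[of _ "\<lambda>z. Re (of_real c * z ^ 0)"] conjI Re_polynomial.mono) auto
    show "continuous_on (sphere 0 r) f" if "P f" for f
    proof -
      from that obtain h where h: "Re_polynomial h" "\<forall>z\<in>sphere 0 r. f z = h z"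
        unfolding P_def by blast
      obtain p where p: "p holomorphic_on UNIV" "\<And>z. h z = Re (p z)"
        using Re_polynomial_entire[OF h(1)] by blast
      have "continuous_on (sphere 0 r) (\<lambda>z. Re (p z))"
        using holomorphic_on_imp_continuous_on[OF p(1)]
        by (intro continuous_intros) (auto intro: continuous_on_subset)
      then show ?thesis
        by (rule continuous_on_eq) (use h(2) p(2) in auto)
    qed
    show "P (\<lambda>x. f x + g x)" if "P f \<and> P g" for f g
    proof -
      from that obtain h1 h2 where "Re_polynomial h1" "\<forall>z\<in>sphere 0 r. f z = h1 z"
        "Re_polynomial h2" "\<forall>z\<in>sphere 0 r. g z = h2 z" unfolding P_def by blast
      then show ?thesis unfolding P_def
        by (intro exI[of _ "\<lambda>z. h1 z + h2 z"]) (auto intro: Re_polynomial.add)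
    qed
    show "P (\<lambda>x. f x * g x)" if "P f \<and> P g" for f g
    proof -
      from that obtain h1 h2 where h: "Re_polynomial h1" "\<forall>z\<in>sphere 0 r. f z = h1 z"
        "Re_polynomial h2" "\<forall>z\<in>sphere 0 r. g z = h2 z" unfolding P_def by blast
      then show ?thesis unfolding P_def
        using Re_polynomial_mult_on_sphere[OF h(1,3), of r] by auto
    qed
    show "\<exists>f. P f \<and> f x \<noteq> f y" if "x \<in> sphere 0 r \<and> y \<in> sphere 0 r \<and> x \<noteq> y" for x y
    proof -
      have "P (\<lambda>z. Re (a * z ^ 1))" for a
        unfolding P_def using Re_polynomial.mono by blast
      then have "P (\<lambda>z. Re (1 * z ^ 1))" "P (\<lambda>z. Re (\<i> * z ^ 1))" by blast+
      then have "P Re" "P (\<lambda>z. - Im z)" by simp_all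
      moreover have "Re x \<noteq> Re y \<or> - Im x \<noteq> - Im y" using that by (auto simp: complex_eq_iff)
      ultimately show ?thesis by blast
    qed
  qed (use assms in auto)
  then obtain g h where g: "\<And>x. x \<in> sphere 0 r \<Longrightarrow> \<bar>u x - g x\<bar> < e" "Re_polynomial h"
    "\<And>z. z \<in> sphere 0 r \<Longrightarrow> g z = h z" unfolding P_def by blast
  obtain p where p: "p holomorphic_on UNIV" "\<And>z. h z = Re (p z)"
    using Re_polynomial_entire[OF g(2)] by blast
  show thesis by (rule that[OF p(1)]) (use g p in auto)
qed

definition circle_mean :: "(complex \<Rightarrow> real) \<Rightarrow> real \<Rightarrow> real" where
  "circle_mean u r = 1 / (2 * pi) * integral {0..2 * pi} (\<lambda>\<theta>. u (of_real r * exp (\<i> * of_real \<theta>)))"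

lemma on_circle: "r \<ge> 0 \<Longrightarrow> of_real r * exp (\<i> * of_real \<theta>) \<in> sphere 0 r"
  by (simp add: norm_mult)

lemma circle_integrable:
  assumes "continuous_on (sphere 0 r) u" "r \<ge> 0"
  shows "(\<lambda>\<theta>. u (of_real r * exp (\<i> * of_real \<theta>)) :: real) integrable_on {0..2 * pi}"
  using on_circle[OF assms(2)]
  by (intro integrable_continuous_real continuous_on_compose2[OF assms(1)] continuous_intros) auto

lemma circle_mean_mono:
  assumes "continuous_on (sphere 0 r) u" "continuous_on (sphere 0 r) v" "r \<ge> 0"
    "\<And>z. z \<in> sphere 0 r \<Longrightarrow> u z \<le> v z"
  shows "circle_mean u r \<le> circle_mean v r"
  unfolding circle_mean_def
  by (intro mult_left_mono integral_le circle_integrable assms on_circle) auto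

lemma circle_mean_add_const:
  assumes "continuous_on (sphere 0 r) u" "r \<ge> 0"
  shows "circle_mean (\<lambda>z. u z + c) r = circle_mean u r + c"
  unfolding circle_mean_def
  using integral_add[OF circle_integrable[OF assms] integrable_const_ivl[of c 0 "2 * pi"]]
  by (simp add: field_simps)

lemma circle_mean_Re_holomorphic:
  assumes "p holomorphic_on cball 0 r" "r > 0"
  shows "circle_mean (\<lambda>z. Re (p z)) r = Re (p 0)"
proof -
  have "((\<lambda>u. p u / (u - 0)) has_contour_integral 2 * of_real pi * \<i> * p 0) (circlepath 0 r)"
    using assms by (intro Cauchy_integral_circlepath)
      (auto intro: holomorphic_on_imp_continuous_on holomorphic_on_subset)
  then have "((\<lambda>t. \<i> * p (of_real r * exp (\<i> * of_real t)))
      has_integral 2 * of_real pi * \<i> * p 0) {0..2 * pi}"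
    unfolding circlepath_def
    by (subst (asm) has_contour_integral_part_circlepath_iff)
      (use assms in \<open>simp_all add: cis_conv_exp field_simps\<close>)
  then have "((\<lambda>t. Im (\<i> * p (of_real r * exp (\<i> * of_real t)))) has_integral
      Im (2 * of_real pi * \<i> * p 0)) {0..2 * pi}"
    by (rule has_integral_Im)
  then have "integral {0..2 * pi} (\<lambda>t. Re (p (of_real r * exp (\<i> * of_real t)))) = 2 * pi * Re (p 0)"
    by (auto dest: integral_unique)
  then show ?thesis by (simp add: circle_mean_def)
qed

text \<open>Approximating \<open>u + e / 2\<close> within \<open>e / 2\<close> on the circle gives a harmonic function above \<open>u\<close> there,
hence inside; its value at the centre is its mean, which exceeds the mean of \<open>u\<close> by at most \<open>e\<close>.\<close>

lemma subharmonic_majorant_on_disc: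
  assumes u: "support_subharmonic u (ball 0 1)" "continuous_on (ball 0 1) u"
    and r: "0 < r" "r < 1" and "e > 0"
  obtains p where "p holomorphic_on UNIV" "\<And>z. norm z \<le> r \<Longrightarrow> u z \<le> Re (p z)"
    "Re (p 0) \<le> circle_mean u r + e"
proof -
  have cu: "continuous_on (sphere 0 r) u" and cu': "continuous_on (cball 0 r) u"
    using r by (auto intro!: continuous_on_subset[OF u(2)])
  obtain p where p: "p holomorphic_on UNIV" "\<And>z. z \<in> sphere 0 r \<Longrightarrow> \<bar>u z + e/2 - Re (p z)\<bar> < e/2"
    using continuous_on_sphere_approx_Re_entire[of r "\<lambda>z. u z + e/2" "e/2"]
      continuous_on_add[OF cu continuous_on_const] half_gt_zero[OF \<open>e > 0\<close>] by metis
  have cp: "continuous_on A (\<lambda>z. Re (p z))" for A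
    using holomorphic_on_imp_continuous_on[OF p(1)]
    by (intro continuous_intros) (auto intro: continuous_on_subset)
  have le: "u z \<le> Re (p z)" if "norm z \<le> r" for z
  proof -
    have "support_subharmonic (\<lambda>z. u z + Re (- p z)) (ball 0 r)"
      using p r by (intro support_subharmonic_add support_subharmonic_Re
          support_subharmonic_subset[OF u(1)] holomorphic_intros) (auto intro: holomorphic_on_subset)
    moreover have "continuous_on (closure (ball 0 r)) (\<lambda>z. u z + Re (- p z))"
      using r by (auto intro!: continuous_intros cu' cp)
    moreover have "u z + Re (- p z) \<le> 0" if "z \<in> frontier (ball 0 r)" for z
    proof -
      have "z \<in> sphere 0 r" using that r by simp
      from p(2)[OF this] show ?thesis unfolding uminus_complex.simps by linarith
    qed
    ultimately have "u z + Re (- p z) \<le> 0"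
      by (rule support_subharmonic_max_principle[OF _ open_ball bounded_ball]) (use that r in auto)
    then show ?thesis by simp
  qed
  have "Re (p 0) = circle_mean (\<lambda>z. Re (p z)) r"
    using r p by (intro circle_mean_Re_holomorphic[symmetric]) (auto intro: holomorphic_on_subset)
  also have "\<dots> \<le> circle_mean (\<lambda>z. u z + e) r"
  proof (rule circle_mean_mono)
    show "Re (p z) \<le> u z + e" if "z \<in> sphere 0 r" for z
      using p(2)[OF that] by linarith
  qed (use cp cu r in \<open>auto intro: continuous_intros\<close>)
  also have "\<dots> = circle_mean u r + e"
    using r by (intro circle_mean_add_const cu) auto
  finally show thesis using that p le by blast
qed

lemma subharmonic_circle_mean_mono:
  assumes u: "support_subharmonic u (ball 0 1)" "continuous_on (ball 0 1) u"
    and r: "0 < r" "r \<le> R" "R < 1"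
  shows "circle_mean u r \<le> circle_mean u R"
proof (rule field_le_epsilon)
  fix e :: real assume "e > 0"
  obtain p where p: "p holomorphic_on UNIV" "\<And>z. norm z \<le> R \<Longrightarrow> u z \<le> Re (p z)"
    "Re (p 0) \<le> circle_mean u R + e"
    using subharmonic_majorant_on_disc[OF u _ _ \<open>e > 0\<close>, of R] r by auto
  have "circle_mean u r \<le> circle_mean (\<lambda>z. Re (p z)) r"
    using p(2) r holomorphic_on_imp_continuous_on[OF p(1)]
    by (intro circle_mean_mono continuous_intros continuous_on_subset[OF u(2)])
      (auto intro: continuous_on_subset)
  also have "\<dots> = Re (p 0)"
    using r p by (intro circle_mean_Re_holomorphic) (auto intro: holomorphic_on_subset)
  finally show "circle_mean u r \<le> circle_mean u R + e" using p(3) by simp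
qed

section \<open>The pseudohyperbolic metric\<close>

lemma norm_one_minus_cnj: "norm (1 - z * cnj w) = norm (1 - w * cnj z)"
  by (metis complex_cnj_cnj complex_cnj_diff complex_cnj_mult complex_cnj_one complex_mod_cnj mult.commute)

lemma ph_dist_commute: "ph_dist z w = ph_dist w z"
  unfolding ph_dist_def norm_divide norm_one_minus_cnj[of z w] by (simp add: norm_minus_commute)

lemma ph_dist_eq_norm_Moebius: "ph_dist l z = norm (Moebius_function 0 l z)"
  by (subst ph_dist_commute) (simp add: ph_dist_def Moebius_function_simple mult.commute)

lemma one_minus_cnj_nonzero: "norm l < 1 \<Longrightarrow> norm z < 1 \<Longrightarrow> 1 - cnj l * z \<noteq> 0"
  by (metis complex_mod_cnj mult_strict_mono' norm_ge_zero norm_mult norm_one mult_1 order_less_irrefl right_minus_eq)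

lemma one_minus_norm_Moebius_sq:
  assumes "norm l < 1" "norm z < 1"
  shows "1 - (norm (Moebius_function 0 l z))\<^sup>2 =
    (1 - (norm l)\<^sup>2) * (1 - (norm z)\<^sup>2) / (norm (1 - cnj l * z))\<^sup>2"
proof -
  have nz: "(norm (1 - cnj l * z))\<^sup>2 \<noteq> 0" using one_minus_cnj_nonzero[OF assms] by simp
  have "(norm (1 - cnj l * z))\<^sup>2 - (norm (z - l))\<^sup>2 = (1 - (norm l)\<^sup>2) * (1 - (norm z)\<^sup>2)"
    unfolding cmod_power2 by (simp add: power2_eq_square algebra_simps)
  then show ?thesis
    using nz by (simp add: Moebius_function_simple norm_divide power_divide field_simps)
qed

text \<open>A pseudohyperbolic disc of fixed radius changes the distance to the circle only by a constant factor;
this is what separates the levels of the iteration below.\<close>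

lemma one_minus_norm_Moebius_ge:
  assumes "norm l < 1" "norm z \<le> s" "s < 1"
  shows "(1 - norm l) * ((1 - s\<^sup>2) / 8) \<le> 1 - norm (Moebius_function 0 l z)"
proof -
  let ?m = "norm (Moebius_function 0 l z)"
  have z: "norm z < 1" using assms by simp
  have m: "?m < 1" by (rule Moebius_function_norm_lt_1[OF assms(1) z])
  have "norm (1 - cnj l * z) \<le> 1 + norm l * norm z"
    using norm_triangle_ineq4[of 1 "cnj l * z"] by (simp add: norm_mult)
  also have "\<dots> \<le> 2" using assms z mult_mono[of "norm l" 1 "norm z" 1] by simp
  finally have d: "(norm (1 - cnj l * z))\<^sup>2 \<le> 2\<^sup>2" by (intro power_mono) auto
  have "s \<ge> 0" using assms(2) norm_ge_zero order_trans by blast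
  then have s: "(norm z)\<^sup>2 \<le> s\<^sup>2" "s\<^sup>2 < 1"
    using assms by (auto intro: power_mono simp: abs_square_less_1)
  have l: "(norm l)\<^sup>2 \<le> norm l" "(norm l)\<^sup>2 < 1"
    using assms(1) by (simp_all add: abs_square_less_1) (simp add: power2_eq_square mult_left_le_one_le)
  have "(1 - norm l) * (1 - s\<^sup>2) / 2\<^sup>2 \<le>
      (1 - (norm l)\<^sup>2) * (1 - (norm z)\<^sup>2) / (norm (1 - cnj l * z))\<^sup>2"
    using s l d assms(1,3) \<open>s \<ge> 0\<close> z one_minus_cnj_nonzero[OF assms(1) z]
    by (intro frac_le mult_mono mult_nonneg_nonneg) (auto simp: abs_square_le_1)
  also have "\<dots> = 1 - ?m\<^sup>2" by (rule one_minus_norm_Moebius_sq[OF assms(1) z, symmetric])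
  also have "\<dots> = (1 - ?m) * (1 + ?m)" by (simp add: power2_eq_square algebra_simps)
  also have "\<dots> \<le> (1 - ?m) * 2" using m by (intro mult_left_mono) auto
  finally show ?thesis by simp
qed

lemma one_minus_norm_comparable:
  assumes "norm l < 1" "norm z < 1" "ph_dist l z \<le> s" "s < 1"
  shows "(1 - norm z) * ((1 - s\<^sup>2) / 8) \<le> 1 - norm l"
proof -
  have "norm (Moebius_function 0 z l) \<le> s"
    using assms(3) by (simp add: ph_dist_eq_norm_Moebius[symmetric] ph_dist_commute[of z l])
  then have "(1 - norm (- z)) * ((1 - s\<^sup>2) / 8)
      \<le> 1 - norm (Moebius_function 0 (- z) (Moebius_function 0 z l))"
    using assms by (intro one_minus_norm_Moebius_ge) auto
  also have "Moebius_function 0 (- z) (Moebius_function 0 z l) = l"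
    using Moebius_function_compose[of "- z" z l] assms by simp
  finally show ?thesis by simp
qed

section \<open>Subharmonic functions that are nonpositive on small discs\<close>

text \<open>The gain from one small disc. On the annulus \<open>f < \<bar>w\<bar> < s1\<close> the function \<open>u\<close> stays below
\<open>\<theta> Re p - M ln (s1 / \<bar>w\<bar>)\<close>: on the outer circle the logarithm vanishes, and on the inner circle, where
\<open>u \<le> 0\<close>, the constant \<open>M\<close> is chosen by Harnack's inequality so that the comparison function is
still nonnegative. Evaluation at \<open>z\<close> gives the factor \<open>1 - c / ln (s1 / f)\<close>, which is at most the exponential.\<close>

lemma annulus_decay:
  assumes s: "0 < r0" "r0 < s1" "s1 < s2"
    and p: "p holomorphic_on ball 0 s2" "\<And>z. norm z < s2 \<Longrightarrow> 0 \<le> Re (p z)"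
    and u: "support_subharmonic u (ball 0 s2)" "continuous_on (ball 0 s2) u"
    and le: "\<And>z. norm z < s2 \<Longrightarrow> u z \<le> \<theta> * Re (p z)" and "\<theta> \<ge> 0"
    and f: "0 < f" "f < 1" "s1 < 1" and core: "\<And>z. norm z < f \<Longrightarrow> norm z < s2 \<Longrightarrow> u z \<le> 0"
    and z: "norm z < r0"
    and c: "c = (s2 - s1) / (s2 + s1) * ((s2 - r0) / (s2 + r0)) * ln (s1 / r0)"
  shows "u z \<le> \<theta> * exp (- c / ln (1 / f)) * Re (p z)"
proof (cases "norm z < f")
  case True
  then show ?thesis
    using core[of z] z s p(2)[of z] \<open>\<theta> \<ge> 0\<close> by (smt (verit) mult_nonneg_nonneg exp_ge_zero)
next
  case False
  then have fz: "f \<le> norm z" by simp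
  have f': "f < s1" "f < s2" using fz z s by auto
  define \<kappa> where "\<kappa> = (s2 - s1) / (s2 + s1) * ((s2 - r0) / (s2 + r0))"
  have \<kappa>: "\<kappa> > 0" using s by (auto simp: \<kappa>_def)
  have anti: "(s2 - y) / (s2 + y) \<le> (s2 - x) / (s2 + x)" if "0 \<le> x" "x \<le> y" for x y :: real
    using that s mult_left_mono[OF that(2), of s2] by (simp add: field_simps)
  have Harn: "\<kappa> * Re (p z) \<le> Re (p w)" if "norm w \<le> s1" for w
  proof -
    have p0: "0 \<le> Re (p 0)" using p(2)[of 0] s by simp
    have "Re (p z) \<le> (s2 + norm z) / (s2 - norm z) * Re (p 0)"
      using Harnack_ball(2)[OF p, of z] s z by simp
    then have "(s2 - norm z) / (s2 + norm z) * Re (p z) \<le> Re (p 0)"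
      using s z by (simp add: field_simps add_pos_nonneg)
    moreover have "(s2 - r0) / (s2 + r0) * Re (p z) \<le> (s2 - norm z) / (s2 + norm z) * Re (p z)"
      using anti[of "norm z" r0] z p(2)[of z] s by (intro mult_right_mono) auto
    ultimately have 1: "(s2 - r0) / (s2 + r0) * Re (p z) \<le> Re (p 0)" by linarith
    have "\<kappa> * Re (p z) = (s2 - s1) / (s2 + s1) * ((s2 - r0) / (s2 + r0) * Re (p z))"
      by (simp add: \<kappa>_def)
    also have "\<dots> \<le> (s2 - s1) / (s2 + s1) * Re (p 0)"
      using 1 s by (intro mult_left_mono) auto
    also have "\<dots> \<le> (s2 - norm w) / (s2 + norm w) * Re (p 0)"
      using anti[of "norm w" s1] that p0 by (intro mult_right_mono) auto
    also have "\<dots> \<le> Re (p w)"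
      using Harnack_ball(1)[OF p, of w] that s by simp
    finally show ?thesis .
  qed
  define M where "M = \<theta> * (\<kappa> * Re (p z)) / ln (s1 / f)"
  have lnf: "ln (s1 / f) > 0" using f f' by simp
  have M: "M \<ge> 0" unfolding M_def using \<open>\<theta> \<ge> 0\<close> \<kappa> p(2)[of z] z s lnf by simp
  define S where "S = {w :: complex. f < norm w \<and> norm w < s1}"
  \<comment> \<open>The comparison function, written as a sum of terms that are evidently subharmonic on \<open>S\<close>.\<close>
  define v where "v = (\<lambda>w. u w + Re (- of_real \<theta> * p w + of_real (M * ln s1)) + (- M) * ln (norm w))"
  have v_eq: "v w = u w - \<theta> * Re (p w) + M * ln (s1 / norm w)" if "w \<noteq> 0" for w
    using that s by (simp add: v_def ln_div algebra_simps)
  have Sop: "open S"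
    unfolding S_def by (intro open_Collect_conj open_Collect_less continuous_intros)
  have Sb: "S \<subseteq> ball 0 s2" using s by (auto simp: S_def)
  have clS: "closure S \<subseteq> {w. f \<le> norm w \<and> norm w \<le> s1}"
    by (rule closure_minimal) (auto simp: S_def intro!: closed_Collect_conj closed_Collect_le continuous_intros)
  have "v z \<le> 0"
  proof (cases "f = norm z")
    case True
    then have "z \<in> closure (ball 0 f)" using f by simp
    then have "u z \<le> 0"
    proof (rule continuous_le_on_closure[rotated])
      show "continuous_on (closure (ball 0 f)) u"
        using f f' by (auto intro: continuous_on_subset[OF u(2)])
    qed (use core f' in auto)
    moreover have "M * ln (s1 / norm z) = \<theta> * (\<kappa> * Re (p z))"
      using True lnf by (simp add: M_def)
    moreover have "\<theta> * (\<kappa> * Re (p z)) \<le> \<theta> * Re (p z)"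
      using Harn[of z] z s \<open>\<theta> \<ge> 0\<close> by (intro mult_left_mono) auto
    ultimately show ?thesis using v_eq[of z] True f by auto
  next
    case False
    then have zS: "z \<in> S" using fz z s by (auto simp: S_def)
    show ?thesis
    proof (rule support_subharmonic_max_principle)
      show "support_subharmonic v S"
        unfolding v_def
      proof (intro support_subharmonic_add support_subharmonic_Re support_subharmonic_ln_norm
          support_subharmonic_subset[OF u(1)] Sop Sb)
        show "(\<lambda>w. - of_real \<theta> * p w + of_real (M * ln s1)) holomorphic_on S"
          using p(1) Sb by (intro holomorphic_intros) (auto intro: holomorphic_on_subset)
        show "(\<lambda>w. w) holomorphic_on S" by (intro holomorphic_intros)
        show "w \<noteq> 0" if "w \<in> S" for w using that f by (auto simp: S_def)
      qed
      show "open S" by fact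
      show "bounded S" by (rule bounded_subset[OF bounded_ball Sb])
      show "continuous_on (closure S) v"
      proof -
        have sub: "closure S \<subseteq> ball 0 s2" "0 \<notin> closure S"
          using clS s f by (auto simp: subset_eq)
        then show ?thesis
          unfolding v_def
          by (intro continuous_intros continuous_on_subset[OF u(2)]
              continuous_on_subset[OF holomorphic_on_imp_continuous_on[OF p(1)]]) auto
      qed
      show "z \<in> closure S" using zS closure_subset by blast
      fix w assume w: "w \<in> frontier S"
      then have "w \<in> closure S" "w \<notin> S"
        using Sop by (auto simp: frontier_def interior_open)
      then consider "norm w = f" | "norm w = s1"
        using clS unfolding S_def by fastforce
      then show "v w \<le> 0"
      proof cases
        case 1
        then have "w \<in> closure (ball 0 f)" using f by simp
        then have "u w \<le> 0"
        proof (rule continuous_le_on_closure[rotated])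
          show "continuous_on (closure (ball 0 f)) u"
            using f f' by (auto intro: continuous_on_subset[OF u(2)])
        qed (use core f' in auto)
        moreover have "M * ln (s1 / norm w) = \<theta> * (\<kappa> * Re (p z))"
          using 1 lnf by (simp add: M_def)
        moreover have "\<theta> * (\<kappa> * Re (p z)) \<le> \<theta> * Re (p w)"
          using Harn[of w] 1 f' \<open>\<theta> \<ge> 0\<close> by (intro mult_left_mono) auto
        ultimately show ?thesis using v_eq[of w] 1 f by auto
      next
        case 2
        then have "w \<noteq> 0" using s by auto
        then show ?thesis using v_eq[of w] le[of w] s 2 by auto
      qed
    qed
  qed
  then have "u z \<le> \<theta> * Re (p z) - M * ln (s1 / norm z)"
    using v_eq[of z] fz f by (cases "z = 0") auto
  also have "\<dots> \<le> \<theta> * Re (p z) - M * ln (s1 / r0)"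
    using M fz f z s order_less_le_trans[OF f(1) fz]
    by (intro diff_left_mono mult_left_mono ln_mono divide_left_mono mult_pos_pos divide_pos_pos) linarith+
  also have "M * ln (s1 / r0) = \<theta> * Re (p z) * (c / ln (s1 / f))"
    by (simp add: M_def c \<kappa>_def)
  also have "\<theta> * Re (p z) - \<theta> * Re (p z) * (c / ln (s1 / f)) = \<theta> * Re (p z) * (1 - c / ln (s1 / f))"
    by (simp add: algebra_simps)
  also have "\<dots> \<le> \<theta> * Re (p z) * exp (- c / ln (1 / f))"
  proof (rule mult_left_mono)
    have "c \<ge> 0" using s by (auto simp: c)
    moreover have "ln (s1 / f) \<le> ln (1 / f)" using f f' by (simp add: divide_right_mono)
    ultimately have "c / ln (1 / f) \<le> c / ln (s1 / f)"
      using lnf by (intro divide_left_mono) auto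
    then show "1 - c / ln (s1 / f) \<le> exp (- c / ln (1 / f))"
      using exp_ge_add_one_self[of "- c / ln (1 / f)"] by simp
    show "0 \<le> \<theta> * Re (p z)" using \<open>\<theta> \<ge> 0\<close> p(2)[of z] z s by simp
  qed
  finally show ?thesis by (simp add: mult_ac)
qed

text \<open>\<open>annulus_decay\<close> transported by the Moebius map that takes \<open>0\<close> to \<open>l\<close>. The constant in front of \<open>t\<close>
accounts for two comparisons of distances to the circle: from \<open>z\<close> to \<open>l\<close>, and from \<open>l\<close> to the points of
the disc of radius \<open>s2\<close> about \<open>l\<close>.\<close>

lemma pseudohyperbolic_decay:
  assumes s: "0 < r0" "r0 < s1" "s1 < s2" "s2 < 1"
    and l: "norm l < 1" and z: "norm z < 1" "ph_dist l z < r0"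
    and u: "support_subharmonic u (ball 0 1)" "continuous_on (ball 0 1) u"
    and p: "p holomorphic_on ball 0 1"
    and t: "t \<le> 1 - norm z"
    and le: "\<And>w. norm w < 1 \<Longrightarrow> ((1 - s2\<^sup>2) / 8)\<^sup>2 * t \<le> 1 - norm w \<Longrightarrow> 0 \<le> Re (p w) \<and> u w \<le> \<theta> * Re (p w)"
    and \<theta>: "\<theta> \<ge> 0"
    and f: "0 < f" "f < 1" and core: "\<And>z. z \<in> ph_disc l f \<Longrightarrow> u z \<le> 0"
    and c: "c = (s2 - s1) / (s2 + s1) * ((s2 - r0) / (s2 + r0)) * ln (s1 / r0)"
  shows "u z \<le> \<theta> * exp (- c / ln (1 / f)) * Re (p z)"
proof -
  define m where "m = Moebius_function 0 (- l)"
  define \<zeta> where "\<zeta> = Moebius_function 0 l z"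
  define q where "q = (1 - s2\<^sup>2) / 8"
  have q: "q \<ge> 0" using s by (simp add: q_def abs_square_le_1)
  have l': "norm (- l) < 1" using l by simp
  have m1: "norm (m w) < 1" if "norm w < 1" for w
    unfolding m_def by (rule Moebius_function_norm_lt_1[OF l' that])
  have mhol: "m holomorphic_on ball 0 s2"
    unfolding m_def using s
    by (intro holomorphic_on_subset[OF Moebius_function_holomorphic[OF l']]) auto
  have \<zeta>: "norm \<zeta> < r0" "m \<zeta> = z"
    using z Moebius_function_compose[of "- l" l z] l
    by (auto simp: \<zeta>_def m_def ph_dist_eq_norm_Moebius)
  have m_inv: "Moebius_function 0 l (m w) = w" if "norm w < 1" for w
    unfolding m_def using Moebius_function_compose[of l "- l" w] l that by simp
  have tl: "t * q \<le> 1 - norm l"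
  proof -
    have "(1 - norm z) * q \<le> 1 - norm l"
      unfolding q_def using l z s by (intro one_minus_norm_comparable) auto
    then show ?thesis using mult_right_mono[OF t q] by linarith
  qed
  have dom: "0 \<le> Re (p (m w)) \<and> u (m w) \<le> \<theta> * Re (p (m w))" if "norm w < s2" for w
  proof (rule le)
    show "norm (m w) < 1" using m1 that s by simp
    have "(1 - norm (- l)) * ((1 - s2\<^sup>2) / 8) \<le> 1 - norm (m w)"
      unfolding m_def by (rule one_minus_norm_Moebius_ge[OF l']) (use that s in auto)
    then have "(1 - norm l) * q \<le> 1 - norm (m w)" by (simp add: q_def)
    moreover have "t * q * q \<le> (1 - norm l) * q" using tl q by (rule mult_right_mono)
    ultimately show "((1 - s2\<^sup>2) / 8)\<^sup>2 * t \<le> 1 - norm (m w)"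
      unfolding q_def[symmetric] by (simp add: power2_eq_square mult_ac)
  qed
  have "u (m \<zeta>) \<le> \<theta> * exp (- c / ln (1 / f)) * Re ((p \<circ> m) \<zeta>)"
  proof (rule annulus_decay[OF s(1-3), where u = "\<lambda>w. u (m w)"])
    have sub: "m ` ball 0 s2 \<subseteq> ball 0 1" using m1 s by auto
    show "(p \<circ> m) holomorphic_on ball 0 s2"
      by (rule holomorphic_on_compose_gen[OF mhol p sub])
    show "support_subharmonic (\<lambda>w. u (m w)) (ball 0 s2)"
      by (rule support_subharmonic_compose[OF u(1) open_ball mhol sub])
    show "continuous_on (ball 0 s2) (\<lambda>w. u (m w))"
      by (rule continuous_on_compose2[OF u(2) holomorphic_on_imp_continuous_on[OF mhol] sub])
    show "u (m w) \<le> 0" if "norm w < f" "norm w < s2" for w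
      using that s m1[of w] m_inv[of w] by (intro core) (auto simp: ph_disc_def ph_dist_eq_norm_Moebius)
  qed (use dom \<zeta> \<open>\<theta> \<ge> 0\<close> f c s in auto)
  then show ?thesis using \<zeta> by simp
qed

text \<open>Downward induction on the level \<open>j\<close>: the bound at level \<open>Suc j\<close> holds on the discs of radius \<open>s2\<close>
about all \<open>l \<in> \<Lambda>\<close> close to points at level \<open>j\<close>. Since \<open>\<phi>\<close> is monotone, the small disc about
\<open>l\<close> has radius at least \<open>\<phi> (q ^ Suc j)\<close>, and \<open>pseudohyperbolic_decay\<close> contributes one more term.\<close>

lemma iterated_decay:
  fixes \<phi> :: "real \<Rightarrow> real"
  assumes s: "0 < r0" "r0 < s1" "s1 < s2" "s2 < 1"
    and \<Lambda>: "\<Lambda> \<subseteq> ball 0 1" "\<And>z. norm z < 1 \<Longrightarrow> \<exists>l\<in>\<Lambda>. z \<in> ph_disc l r0"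
    and \<phi>: "\<And>t. t \<in> {0<..1} \<Longrightarrow> \<phi> t \<in> {0<..<1}" "mono_on {0<..1} \<phi>"
    and u: "support_subharmonic u (ball 0 1)" "continuous_on (ball 0 1) u"
    and core: "\<And>z. z \<in> disc_union \<Lambda> \<phi> \<Longrightarrow> u z \<le> 0"
    and p: "p holomorphic_on ball 0 1"
    and q: "q = ((1 - s2\<^sup>2) / 8)\<^sup>2"
    and le: "\<And>w. q ^ n \<le> 1 - norm w \<Longrightarrow> 0 \<le> Re (p w) \<and> u w \<le> Re (p w)"
    and c: "c = (s2 - s1) / (s2 + s1) * ((s2 - r0) / (s2 + r0)) * ln (s1 / r0)"
    and jn: "j \<le> n" and z: "q ^ j \<le> 1 - norm z"
  shows "u z \<le> exp (- c * (\<Sum>m\<in>{j<..n}. 1 / ln (1 / \<phi> (q ^ m)))) * Re (p z)"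
  using jn z
proof (induction j arbitrary: z rule: inc_induct)
  case base
  then show ?case using le[of z] by simp
next
  case (step j)
  have "s2\<^sup>2 < 1" "0 \<le> s2\<^sup>2" using s by (auto simp: abs_square_less_1)
  have "0 < (1 - s2\<^sup>2) / 8" using \<open>s2\<^sup>2 < 1\<close> by simp
  have sq: "0 < b\<^sup>2 \<and> b\<^sup>2 < 1" if "0 < b" "b < 1" for b :: real
    using that by (simp add: abs_square_less_1)
  have "- (s2\<^sup>2) < 7" using zero_le_power2[of s2] by linarith
  then have "(1 - s2\<^sup>2) / 8 < 1" by simp
  have q01: "0 < q" "q < 1"
    using sq[OF \<open>0 < (1 - s2\<^sup>2) / 8\<close> \<open>(1 - s2\<^sup>2) / 8 < 1\<close>] unfolding q by auto
  have qm: "q ^ m \<in> {0<..1}" for m using q01 by (auto simp: power_le_one)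
  have z1: "norm z < 1" using step.prems qm[of j] by (auto intro: order_less_le_trans)
  obtain l where l: "l \<in> \<Lambda>" "z \<in> ph_disc l r0" using \<Lambda>(2)[OF z1] by blast
  then have l1: "norm l < 1" "ph_dist l z < r0" using \<Lambda>(1) by (auto simp: ph_disc_def)
  define \<theta> where "\<theta> = exp (- c * (\<Sum>m\<in>{Suc j<..n}. 1 / ln (1 / \<phi> (q ^ m))))"
  define f where "f = \<phi> (q ^ Suc j)"
  have "u z \<le> \<theta> * exp (- c / ln (1 / f)) * Re (p z)"
  proof (rule pseudohyperbolic_decay[OF s l1(1) z1 l1(2) u p step.prems])
    show "0 \<le> Re (p w) \<and> u w \<le> \<theta> * Re (p w)"
      if "((1 - s2\<^sup>2) / 8)\<^sup>2 * q ^ j \<le> 1 - norm w" for w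
    proof -
      have w: "q ^ Suc j \<le> 1 - norm w" using that by (simp add: q)
      have "q ^ n \<le> q ^ Suc j" using step.hyps q01 by (intro power_decreasing) auto
      then show ?thesis using step.IH[OF w] le[of w] w by (auto simp: \<theta>_def)
    qed
    show "0 < f" "f < 1" using \<phi>(1)[OF qm[of "Suc j"]] by (auto simp: f_def)
    show "u w \<le> 0" if "w \<in> ph_disc l f" for w
    proof (rule core)
      define b where "b = (1 - s2\<^sup>2) / 8"
      have b: "0 < b" "b < 1" "q = b * b" using \<open>0 < (1 - s2\<^sup>2) / 8\<close> \<open>(1 - s2\<^sup>2) / 8 < 1\<close> by (auto simp: b_def q power2_eq_square)
      have "(1 - norm z) * b \<le> 1 - norm l"
        unfolding b_def using l1 z1 s by (intro one_minus_norm_comparable) auto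
      then have "q ^ j * b \<le> 1 - norm l"
        using mult_right_mono[OF step.prems, of b] b by linarith
      moreover have "q ^ Suc j \<le> q ^ j * b"
        using b qm[of j] by (simp add: mult_left_le_one_le)
      ultimately have "q ^ Suc j \<le> 1 - norm l" by linarith
      then have "f \<le> \<phi> (1 - norm l)"
        unfolding f_def using qm[of "Suc j"] l1 by (intro mono_onD[OF \<phi>(2)]) auto
      then show "w \<in> disc_union \<Lambda> \<phi>"
        using that l(1) by (force simp: disc_union_def ph_disc_def)
    qed
  qed (auto simp: \<theta>_def c)
  also have "\<theta> * exp (- c / ln (1 / f)) = exp (- c * (\<Sum>m\<in>{j<..n}. 1 / ln (1 / \<phi> (q ^ m))))"
  proof -
    have "{j<..n} = insert (Suc j) {Suc j<..n}" using step.hyps by auto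
    then show ?thesis by (simp add: \<theta>_def f_def exp_add[symmetric] algebra_simps)
  qed
  finally show ?case .
qed

text \<open>For each \<open>n\<close> let the majorant \<open>Re p\<close> of \<open>v\<close> on the disc of radius \<open>1 - q ^ n\<close> have value at most \<open>B + 1\<close>
at \<open>0\<close>. By Harnack's inequality \<open>Re (p z)\<close> is bounded uniformly in \<open>n\<close>, whereas the factor
from \<open>iterated_decay\<close> tends to \<open>0\<close> with \<open>n\<close>.\<close>

theorem subharmonic_nonpos_of_dense_discs:
  fixes \<phi> :: "real \<Rightarrow> real"
  assumes r0: "0 < r0" "r0 < 1"
    and \<Lambda>: "\<Lambda> \<subseteq> ball 0 1" "\<And>z. norm z < 1 \<Longrightarrow> \<exists>l\<in>\<Lambda>. z \<in> ph_disc l r0"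
    and \<phi>: "\<And>t. t \<in> {0<..1} \<Longrightarrow> \<phi> t \<in> {0<..<1}" "mono_on {0<..1} \<phi>"
    and u: "support_subharmonic u (ball 0 1)" "continuous_on (ball 0 1) u"
    and core: "\<And>z. z \<in> disc_union \<Lambda> \<phi> \<Longrightarrow> u z \<le> 0"
    and v: "support_subharmonic v (ball 0 1)" "continuous_on (ball 0 1) v"
      "\<And>z. norm z < 1 \<Longrightarrow> 0 \<le> v z" "\<And>z. norm z < 1 \<Longrightarrow> u z \<le> v z"
    and bd: "\<And>r. 0 < r \<Longrightarrow> r < 1 \<Longrightarrow> circle_mean v r \<le> B"
    and div: "\<And>q. 0 < q \<Longrightarrow> q < 1 \<Longrightarrow> \<not> summable (\<lambda>m. 1 / ln (1 / \<phi> (q ^ m)))"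
    and z: "norm z < 1"
  shows "u z \<le> 0"
proof -
  \<comment> \<open>Any radii \<open>r0 < s1 < s2 < 1\<close> serve; they fix the ratio \<open>q\<close> of the levels and the constant \<open>c\<close>.\<close>
  obtain s1 where s1: "r0 < s1" "s1 < 1" using dense r0 by blast
  obtain s2 where s2: "s1 < s2" "s2 < 1" using dense s1 by blast
  define c where "c = (s2 - s1) / (s2 + s1) * ((s2 - r0) / (s2 + r0)) * ln (s1 / r0)"
  have c: "c > 0" using r0 s1 s2 by (auto simp: c_def)
  define q where "q = ((1 - s2\<^sup>2) / 8)\<^sup>2"
  have "s2\<^sup>2 < 1" "0 \<le> s2\<^sup>2" using s1 s2 r0 by (auto simp: abs_square_less_1)
  have "0 < (1 - s2\<^sup>2) / 8" using \<open>s2\<^sup>2 < 1\<close> by simp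
  have sq: "0 < b\<^sup>2 \<and> b\<^sup>2 < 1" if "0 < b" "b < 1" for b :: real
    using that by (simp add: abs_square_less_1)
  have "- (s2\<^sup>2) < 7" using zero_le_power2[of s2] by linarith
  then have "(1 - s2\<^sup>2) / 8 < 1" by simp
  have q: "0 < q" "q < 1"
    using sq[OF \<open>0 < (1 - s2\<^sup>2) / 8\<close> \<open>(1 - s2\<^sup>2) / 8 < 1\<close>] unfolding q_def by auto
  define a where "a = (\<lambda>m. 1 / ln (1 / \<phi> (q ^ m)))"
  have a: "a m \<ge> 0" for m
    using \<phi>(1)[of "q ^ m"] q by (auto simp: a_def power_le_one)
  obtain j where j: "q ^ j < 1 - norm z" using real_arch_pow_inv[of "1 - norm z" q] z q by auto
  define d where "d = q ^ j - q ^ Suc j"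
  have d: "d > 0" using q by (simp add: d_def)
  \<comment> \<open>The Harnack constant for \<open>z\<close> relative to the discs of radius \<open>1 - q ^ n\<close>, \<open>n > j\<close>, whose boundary circles have distance at least \<open>d\<close> from \<open>z\<close>.\<close>
  define K where "K = 2 / d * (B + 1)"
  have bound: "u z \<le> exp (- c * (\<Sum>m\<in>{j<..n}. a m)) * K" if n: "n > j" for n
  proof -
    define R where "R = 1 - q ^ n"
    have qn: "q ^ n \<le> q ^ Suc j" "q ^ n < 1" "0 < q ^ n"
      using n q power_decreasing[of "Suc j" n q] by (simp_all add: power_less_one_iff)
    have R: "0 < R" "R < 1" "norm z + d \<le> R"
      using qn j by (auto simp: R_def d_def)
    obtain p where p: "p holomorphic_on UNIV" "\<And>z. norm z \<le> R \<Longrightarrow> v z \<le> Re (p z)"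
      "Re (p 0) \<le> circle_mean v R + 1"
      using subharmonic_majorant_on_disc[OF v(1,2) R(1,2), of 1] by auto
    have pos: "0 \<le> Re (p w)" if "norm w \<le> R" for w
      using p(2)[OF that] v(3)[of w] that R by linarith
    have p0: "Re (p 0) \<le> B + 1" using p(3) bd[OF R(1,2)] by simp
    have "u z \<le> exp (- c * (\<Sum>m\<in>{j<..n}. a m)) * Re (p z)"
      unfolding a_def
    proof (rule iterated_decay[OF r0(1) s1(1) s2 \<Lambda> \<phi> u core _ q_def _ c_def])
      show "0 \<le> Re (p w) \<and> u w \<le> Re (p w)" if "q ^ n \<le> 1 - norm w" for w
        using pos[of w] p(2)[of w] v(4)[of w] that R by (auto simp: R_def)
    qed (use p n j in \<open>auto intro: holomorphic_on_subset\<close>)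
    also have "\<dots> \<le> exp (- c * (\<Sum>m\<in>{j<..n}. a m)) * K"
    proof (rule mult_left_mono)
      have "Re (p z) \<le> (R + norm z) / (R - norm z) * Re (p 0)"
        by (rule Harnack_ball) (use p pos R d in \<open>auto intro: holomorphic_on_subset\<close>)
      also have "\<dots> \<le> 2 / d * Re (p 0)"
        using R d z pos[of 0] by (intro mult_right_mono frac_le) auto
      also have "\<dots> \<le> K" unfolding K_def using p0 d by (intro mult_left_mono) auto
      finally show "Re (p z) \<le> K" .
    qed simp
    finally show ?thesis .
  qed
  have sum_eq: "(\<Sum>m\<in>{j<..n}. a m) = (\<Sum>i<n - j. a (i + Suc j))" if "n > j" for n
    by (rule sum.reindex_bij_witness[of _ "\<lambda>i. i + Suc j" "\<lambda>m. m - Suc j"]) (use that in auto)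
  have "\<not> summable (\<lambda>i. a (i + Suc j))"
    using div[OF q] unfolding summable_iff_shift[of a "Suc j"] by (simp add: a_def)
  have unb: "\<exists>k. (\<Sum>i<k. a (i + Suc j)) > x" for x
  proof (rule ccontr)
    assume "\<not> ?thesis"
    then have "summable (\<lambda>i. a (i + Suc j))"
      by (intro summableI_nonneg_bounded[of _ x]) (auto simp: a not_less)
    then show False using \<open>\<not> summable (\<lambda>i. a (i + Suc j))\<close> by simp
  qed
  show ?thesis
  proof (rule ccontr)
    assume "\<not> u z \<le> 0"
    then have pos: "u z > 0" by simp
    obtain k where k: "(\<Sum>i<k. a (i + Suc j)) > max 0 (K / u z) / c" using unb by blast
    have "0 \<le> max 0 (K / u z) / c" using c by (intro divide_nonneg_pos) auto
    then have "k > 0" using k by (cases k) auto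
    have S: "(\<Sum>m\<in>{j<..k + j}. a m) = (\<Sum>i<k. a (i + Suc j))"
      using sum_eq[of "k + j"] \<open>k > 0\<close> by simp
    define x where "x = c * (\<Sum>i<k. a (i + Suc j))"
    have x: "x > K / u z" "x > 0" using k c by (auto simp: x_def field_simps max_def split: if_splits)
    have "u z \<le> exp (- x) * K"
      using bound[of "k + j"] \<open>k > 0\<close> by (simp add: S x_def)
    then have "u z * exp x \<le> K"
      by (simp add: exp_minus field_simps)
    moreover have "u z * x \<le> u z * exp x"
      using pos order_trans[OF _ exp_ge_add_one_self, of x x] by (intro mult_left_mono) auto
    moreover have "K < u z * x" using x(1) pos by (simp add: field_simps)
    ultimately show False by linarith
  qed
qed

section \<open>The integral and geometric series\<close>

lemma reciprocal_log_mono: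
  fixes x y :: real
  assumes "0 < x" "x \<le> y" "y < 1"
  shows "1 / ln (1 / x) \<le> 1 / ln (1 / y)"
  using assms by (intro divide_left_mono ln_mono mult_pos_pos) (auto simp: frac_le)

lemma geometric_shells:
  fixes q :: real
  assumes "0 < q" "q < 1"
  shows "disjoint_family (\<lambda>m. {q ^ Suc m<..q ^ m})" and "(\<Union>m. {q ^ Suc m<..q ^ m}) = {0<..1}"
proof -
  have "{q ^ Suc m<..q ^ m} \<inter> {q ^ Suc n<..q ^ n} = {}" if "m < n" for m n
    using power_decreasing[of "Suc m" n q] that assms by auto
  then show "disjoint_family (\<lambda>m. {q ^ Suc m<..q ^ m})"
    unfolding disjoint_family_on_def by (metis Int_commute linorder_neqE_nat)
  show "(\<Union>m. {q ^ Suc m<..q ^ m}) = {0<..1}"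
  proof (intro equalityI subsetI)
    fix t assume "t \<in> {0<..1::real}"
    then have t: "0 < t" "t \<le> 1" by auto
    define n where "n = (LEAST n. q ^ n < t)"
    have ex: "\<exists>n. q ^ n < t" using real_arch_pow_inv[OF t(1) assms(2)] .
    have n: "q ^ n < t" unfolding n_def by (rule LeastI_ex[OF ex])
    then obtain m where m: "n = Suc m" using t by (cases n) auto
    then have "\<not> q ^ m < t" using not_less_Least[of m "\<lambda>n. q ^ n < t"] by (simp add: n_def)
    then show "t \<in> (\<Union>m. {q ^ Suc m<..q ^ m})" using n m by auto
  next
    fix t assume "t \<in> (\<Union>m. {q ^ Suc m<..q ^ m})"
    then obtain m where m: "q ^ Suc m < t" "t \<le> q ^ m" by auto
    have "0 < q ^ Suc m" "q ^ m \<le> 1" using assms by (auto simp: power_le_one)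
    then show "t \<in> {0<..1}" using m by auto
  qed
qed

lemma nn_integral_inverse_shell:
  fixes a b :: real
  assumes "0 < a" "a \<le> b"
  shows "(\<integral>\<^sup>+ t \<in> {a<..b}. ennreal (1 / t) \<partial>lborel) = ennreal (ln (b / a))"
proof -
  have "(\<integral>\<^sup>+ t \<in> {a<..b}. ennreal (1 / t) \<partial>lborel) = (\<integral>\<^sup>+ t \<in> {a..b}. ennreal (1 / t) \<partial>lborel)"
    using AE_lborel_singleton[of a]
    by (intro nn_integral_cong_AE, eventually_elim) (auto simp: indicator_def)
  also have "\<dots> = ennreal (ln b - ln a)"
    using assms by (intro nn_integral_FTC_Icc) (auto intro!: derivative_eq_intros)
  finally show ?thesis using assms by (simp add: ln_div)
qed

text \<open>The shell \<open>q ^ Suc m < t \<le> q ^ m\<close> has mass \<open>ln (1 / q)\<close> for \<open>dt / t\<close>, and on it the monotone weight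
\<open>1 / ln (1 / \<phi> t)\<close> lies between its values at the end points. Hence the integral over the shell lies
between consecutive terms of the series, up to that constant factor.\<close>

lemma integral_infinite_iff_geometric_series_diverges:
  fixes \<phi> :: "real \<Rightarrow> real"
  assumes \<phi>: "\<And>t. t \<in> {0<..1} \<Longrightarrow> \<phi> t \<in> {0<..<1}" "mono_on {0<..1} \<phi>"
    and cont: "continuous_on {0<..1} \<phi>"
    and q: "0 < q" "q < 1"
  shows "(\<integral>\<^sup>+ t \<in> {0<..1}. ennreal (1 / (t * ln (1 / \<phi> t))) \<partial>lborel) = \<infinity> \<longleftrightarrow>
    \<not> summable (\<lambda>m. 1 / ln (1 / \<phi> (q ^ m)))"
proof -
  define g where "g = (\<lambda>t. 1 / ln (1 / \<phi> t))"
  define b where "b = ln (1 / q)"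
  have b: "b > 0" using q by (simp add: b_def)
  have lnpos: "ln (1 / \<phi> t) > 0" if "t \<in> {0<..1}" for t
    using \<phi>(1)[OF that] by simp
  have gpos: "g t > 0" if "t \<in> {0<..1}" for t
    using lnpos[OF that] by (simp add: g_def)
  have gmono: "g s \<le> g t" if "s \<in> {0<..1}" "t \<in> {0<..1}" "s \<le> t" for s t
  proof -
    have "\<phi> s \<le> \<phi> t" using mono_onD[OF \<phi>(2)] that by blast
    then show ?thesis
      unfolding g_def using \<phi>(1)[OF that(1)] \<phi>(1)[OF that(2)]
      by (intro reciprocal_log_mono) auto
  qed
  have qm: "q ^ m \<in> {0<..1}" for m using q by (auto simp: power_le_one)
  define I where "I = (\<lambda>m. {q ^ Suc m<..q ^ m})"
  have I: "I m \<subseteq> {0<..1}" for m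
    using geometric_shells(2)[OF q] unfolding I_def by blast
  have meas: "(\<lambda>t. ennreal (1 / (t * ln (1 / \<phi> t))) * indicator {0<..1} t) \<in> borel_measurable lborel"
  proof -
    have "continuous_on {0<..1} (\<lambda>t. 1 / (t * ln (1 / \<phi> t)))"
      using lnpos \<phi>(1) by (intro continuous_intros cont) force+
    then have "(\<lambda>t. indicator {0<..1} t *\<^sub>R (1 / (t * ln (1 / \<phi> t)))) \<in> borel_measurable borel"
      by (intro borel_measurable_continuous_on_indicator) auto
    then have "(\<lambda>t. ennreal (indicator {0<..1} t *\<^sub>R (1 / (t * ln (1 / \<phi> t))))) \<in> borel_measurable lborel"
      by simp
    also have "(\<lambda>t. ennreal (indicator {0<..1} t *\<^sub>R (1 / (t * ln (1 / \<phi> t))))) =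
       (\<lambda>t. ennreal (1 / (t * ln (1 / \<phi> t))) * indicator {0<..1} t)"
      by (auto simp: indicator_def)
    finally show ?thesis .
  qed
  define G where "G = (\<lambda>m. \<integral>\<^sup>+ t \<in> I m. ennreal (1 / (t * ln (1 / \<phi> t))) \<partial>lborel)"
  have total: "(\<integral>\<^sup>+ t \<in> {0<..1}. ennreal (1 / (t * ln (1 / \<phi> t))) \<partial>lborel) = (\<Sum>m. G m)"
  proof -
    have "(\<integral>\<^sup>+ t \<in> {0<..1}. ennreal (1 / (t * ln (1 / \<phi> t))) \<partial>lborel) =
       (\<integral>\<^sup>+ t \<in> (\<Union>m. I m). (ennreal (1 / (t * ln (1 / \<phi> t))) * indicator {0<..1} t) \<partial>lborel)"
      unfolding I_def geometric_shells(2)[OF q]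
      by (intro nn_integral_cong) (auto simp: indicator_def)
    also have "\<dots> = (\<Sum>m. \<integral>\<^sup>+ t \<in> I m. (ennreal (1 / (t * ln (1 / \<phi> t))) * indicator {0<..1} t) \<partial>lborel)"
      by (rule nn_integral_disjoint_family[OF meas])
        (use geometric_shells(1)[OF q] in \<open>auto simp: I_def\<close>)
    also have "\<dots> = (\<Sum>m. G m)"
      unfolding G_def using I
      by (intro suminf_cong nn_integral_cong) (auto simp: indicator_def subset_iff)
    finally show ?thesis .
  qed
  have shell: "(\<integral>\<^sup>+ t \<in> I m. ennreal (c * (1 / t)) \<partial>lborel) = ennreal (c * b)" if "c \<ge> 0" for c m
  proof -
    have "(\<integral>\<^sup>+ t \<in> I m. ennreal (c * (1 / t)) \<partial>lborel) =
        (\<integral>\<^sup>+ t. ennreal c * (ennreal (1 / t) * indicator (I m) t) \<partial>lborel)"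
      by (intro nn_integral_cong) (simp only: ennreal_mult'[OF that] mult.assoc)
    also have "\<dots> = ennreal c * (\<integral>\<^sup>+ t \<in> I m. ennreal (1 / t) \<partial>lborel)"
      by (rule nn_integral_cmult) (simp add: I_def)
    also have "\<dots> = ennreal c * ennreal (ln (q ^ m / q ^ Suc m))"
      unfolding I_def using q by (subst nn_integral_inverse_shell) auto
    also have "q ^ m / q ^ Suc m = 1 / q" using q by simp
    finally show ?thesis using that b by (simp add: b_def ennreal_mult)
  qed
  have upper: "G m \<le> ennreal (g (q ^ m) * b)" for m
  proof -
    have "G m \<le> (\<integral>\<^sup>+ t \<in> I m. ennreal (g (q ^ m) * (1 / t)) \<partial>lborel)"
      unfolding G_def
    proof (intro nn_integral_mono)
      fix t
      show "ennreal (1 / (t * ln (1 / \<phi> t))) * indicator (I m) t \<le>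
          ennreal (g (q ^ m) * (1 / t)) * indicator (I m) t"
      proof (cases "t \<in> I m")
        case True
        then have "g t \<le> g (q ^ m)" using I[of m] qm[of m] by (intro gmono) (auto simp: I_def)
        then have "g t * (1 / t) \<le> g (q ^ m) * (1 / t)"
          using True I[of m] by (intro mult_right_mono) auto
        then show ?thesis using True by (simp add: g_def ennreal_leI mult.commute)
      qed simp
    qed
    also have "\<dots> = ennreal (g (q ^ m) * b)" using gpos[OF qm[of m]] by (intro shell) simp
    finally show ?thesis .
  qed
  have lower: "ennreal (g (q ^ Suc m) * b) \<le> G m" for m
  proof -
    have "ennreal (g (q ^ Suc m) * b) = (\<integral>\<^sup>+ t \<in> I m. ennreal (g (q ^ Suc m) * (1 / t)) \<partial>lborel)"
      using gpos[OF qm[of "Suc m"]] by (intro shell[symmetric]) simp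
    also have "\<dots> \<le> G m"
      unfolding G_def
    proof (intro nn_integral_mono)
      fix t
      show "ennreal (g (q ^ Suc m) * (1 / t)) * indicator (I m) t \<le>
          ennreal (1 / (t * ln (1 / \<phi> t))) * indicator (I m) t"
      proof (cases "t \<in> I m")
        case True
        then have "g (q ^ Suc m) \<le> g t" using I[of m] qm[of "Suc m"] by (intro gmono) (auto simp: I_def)
        then have "g (q ^ Suc m) * (1 / t) \<le> g t * (1 / t)"
          using True I[of m] by (intro mult_right_mono) auto
        then show ?thesis using True by (simp add: g_def ennreal_leI mult.commute)
      qed simp
    qed
    finally show ?thesis .
  qed
  have nn: "0 \<le> g (q ^ m) * b" for m using gpos[OF qm[of m]] b by simp
  show ?thesis
  proof
    assume inf: "(\<integral>\<^sup>+ t \<in> {0<..1}. ennreal (1 / (t * ln (1 / \<phi> t))) \<partial>lborel) = \<infinity>"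
    show "\<not> summable (\<lambda>m. 1 / ln (1 / \<phi> (q ^ m)))"
    proof
      assume "summable (\<lambda>m. 1 / ln (1 / \<phi> (q ^ m)))"
      then have "summable (\<lambda>m. g (q ^ m) * b)"
        unfolding g_def by (rule summable_mult2)
      then have "(\<Sum>m. ennreal (g (q ^ m) * b)) = ennreal (\<Sum>m. g (q ^ m) * b)"
        using nn by (intro suminf_ennreal2) auto
      moreover have "(\<Sum>m. G m) \<le> (\<Sum>m. ennreal (g (q ^ m) * b))"
        by (intro suminf_le upper) auto
      ultimately show False using inf total by (simp add: top_unique)
    qed
  next
    assume div: "\<not> summable (\<lambda>m. 1 / ln (1 / \<phi> (q ^ m)))"
    show "(\<integral>\<^sup>+ t \<in> {0<..1}. ennreal (1 / (t * ln (1 / \<phi> t))) \<partial>lborel) = \<infinity>"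
    proof (rule ccontr)
      assume fin: "\<not> ?thesis"
      have "(\<Sum>m. ennreal (g (q ^ Suc m) * b)) \<le> (\<Sum>m. G m)"
        by (intro suminf_le lower) auto
      then have "(\<Sum>m. ennreal (g (q ^ Suc m) * b)) \<noteq> top"
        using fin total by (auto simp: top_unique)
      then have "summable (\<lambda>m. g (q ^ Suc m) * b)"
        by (rule summable_suminf_not_top[OF nn])
      then have "summable (\<lambda>m. g (q ^ Suc m))"
        using b summable_mult2[of "\<lambda>m. g (q ^ Suc m) * b" "1 / b"] by simp
      then have "summable (\<lambda>m. g (q ^ m))" by (simp only: summable_Suc_iff[of "\<lambda>m. g (q ^ m)"])
      then show False using div by (simp add: g_def)
    qed
  qed
qed

section \<open>Divergence implies sampling\<close>

lemma log_plus_eq_ln_max: "0 \<le> x \<Longrightarrow> log_plus x = ln (max 1 x)"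
  by (cases "x = 0") (auto simp: log_plus_def max_def not_le ln_le_zero_iff)

lemma continuous_on_log_plus_norm:
  assumes "f holomorphic_on S"
  shows "continuous_on S (\<lambda>z. log_plus (norm (f z)))"
  unfolding log_plus_eq_ln_max[OF norm_ge_zero]
  using holomorphic_on_imp_continuous_on[OF assms]
  by (intro continuous_intros) (auto simp: max_def)

lemma continuous_on_ln_one_plus_norm:
  assumes "f holomorphic_on S"
  shows "continuous_on S (\<lambda>z. ln (1 + norm (f z)))"
  using holomorphic_on_imp_continuous_on[OF assms]
  by (intro continuous_intros) (auto simp: add_nonneg_eq_0_iff)

lemma ln_one_plus_le_log_plus: "0 \<le> x \<Longrightarrow> ln (1 + x) \<le> log_plus x + ln 2"
proof -
  assume x: "0 \<le> x"
  have "ln (1 + x) \<le> ln (max 1 x * 2)" using x by (intro ln_mono) auto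
  also have "\<dots> = ln (max 1 x) + ln 2" using max.cobounded1[of 1 x] by (intro ln_mult_pos) linarith+
  finally show ?thesis using x by (simp add: log_plus_eq_ln_max)
qed

text \<open>The means of the positive part of \<open>ln \<bar>f\<bar>\<close> increase with the radius, so their limit bounds all of them,
and \<open>ln (1 + x)\<close> exceeds \<open>log_plus x\<close> by at most \<open>ln 2\<close>.\<close>

lemma nevanlinna_circle_mean_bounded:
  assumes "f \<in> nevanlinna"
  obtains B where "\<And>r. 0 < r \<Longrightarrow> r < 1 \<Longrightarrow> circle_mean (\<lambda>z. ln (1 + norm (f z))) r \<le> B"
proof -
  from assms obtain L where f: "f holomorphic_on ball 0 1"
    and L: "((\<lambda>r. circle_mean (\<lambda>z. log_plus (norm (f z))) r) \<longlongrightarrow> L) (at_left 1)"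
    unfolding nevanlinna_def circle_mean_def by blast
  have le: "circle_mean (\<lambda>z. log_plus (norm (f z))) r \<le> L" if r: "0 < r" "r < 1" for r
  proof (rule tendsto_lowerbound[OF L])
    show "eventually (\<lambda>R. circle_mean (\<lambda>z. log_plus (norm (f z))) r \<le> circle_mean (\<lambda>z. log_plus (norm (f z))) R) (at_left 1)"
      using eventually_at_left_real[OF r(2)]
      by eventually_elim (use r f in \<open>auto intro!: subharmonic_circle_mean_mono
          support_subharmonic_log_plus_norm continuous_on_log_plus_norm\<close>)
  qed simp
  show thesis
  proof (rule that)
    fix r :: real assume r: "0 < r" "r < 1"
    have f': "f holomorphic_on sphere 0 r" using r by (intro holomorphic_on_subset[OF f]) auto
    have "circle_mean (\<lambda>z. ln (1 + norm (f z))) r \<le> circle_mean (\<lambda>z. log_plus (norm (f z)) + ln 2) r"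
      using r by (intro circle_mean_mono continuous_on_ln_one_plus_norm continuous_on_add
          continuous_on_log_plus_norm f' continuous_on_const ln_one_plus_le_log_plus) auto
    also have "\<dots> = circle_mean (\<lambda>z. log_plus (norm (f z))) r + ln 2"
      using r by (intro circle_mean_add_const continuous_on_log_plus_norm f') auto
    also have "\<dots> \<le> L + ln 2" using le[OF r] by simp
    finally show "circle_mean (\<lambda>z. ln (1 + norm (f z))) r \<le> L + ln 2" .
  qed
qed

text \<open>The functions competing in \<open>Nev_on f\<close> for the union of small discs already dominate \<open>ln (1 + \<bar>f\<bar>)\<close> on
the whole disc, so the two infima coincide and any positive sampling constant will do.\<close>

theorem sampling_if_series_diverges:
  fixes \<phi> :: "real \<Rightarrow> real"
  assumes \<Lambda>: "uniformly_dense \<Lambda>"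
    and \<phi>: "\<And>t. t \<in> {0<..1} \<Longrightarrow> \<phi> t \<in> {0<..<1}" "mono_on {0<..1} \<phi>"
    and div: "\<And>q. 0 < q \<Longrightarrow> q < 1 \<Longrightarrow> \<not> summable (\<lambda>m. 1 / ln (1 / \<phi> (q ^ m)))"
  shows "sampling_nevanlinna (disc_union \<Lambda> \<phi>)"
proof -
  from \<Lambda> obtain r0 where r0: "0 < r0" "r0 < 1" and sub: "\<Lambda> \<subseteq> ball 0 1"
    and cover: "ball 0 1 = (\<Union>z\<in>\<Lambda>. ph_disc z r0)"
    unfolding uniformly_dense_def by blast
  have Nev_le: "Nev f \<le> Nev_on f (disc_union \<Lambda> \<phi>)" if f: "f \<in> nevanlinna" for f
  proof -
    obtain B where B: "\<And>r. 0 < r \<Longrightarrow> r < 1 \<Longrightarrow> circle_mean (\<lambda>z. ln (1 + norm (f z))) r \<le> B"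
      using nevanlinna_circle_mean_bounded[OF f] by blast
    have hol: "f holomorphic_on ball 0 1" using f by (simp add: nevanlinna_def)
    have "ln (1 + norm (f z)) \<le> h z"
      if h: "h \<in> Har_plus" "\<forall>z\<in>disc_union \<Lambda> \<phi>. ln (1 + norm (f z)) \<le> h z" and z: "norm z < 1" for h z
    proof -
      obtain F where F: "F holomorphic_on ball 0 1" "\<And>w. norm w < 1 \<Longrightarrow> h w = Re (F w)"
        "\<And>w. norm w < 1 \<Longrightarrow> 0 \<le> h w"
        using Har_plusE[OF h(1)] by blast
      define u where "u = (\<lambda>z. ln (1 + norm (f z)) + Re (- F z))"
      have "u z \<le> 0"
      proof (rule subharmonic_nonpos_of_dense_discs[where v = "\<lambda>z. ln (1 + norm (f z))", OF r0 sub _ \<phi>])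
        show "\<exists>l\<in>\<Lambda>. w \<in> ph_disc l r0" if "norm w < 1" for w
          using that cover by (auto simp flip: mem_ball_0)
        show "support_subharmonic (\<lambda>z. ln (1 + norm (f z))) (ball 0 1)"
          by (intro support_subharmonic_ln_one_plus_norm hol) auto
        then show "support_subharmonic u (ball 0 1)"
          unfolding u_def
          by (intro support_subharmonic_add support_subharmonic_Re holomorphic_intros F) auto
        show "continuous_on (ball 0 1) (\<lambda>z. ln (1 + norm (f z)))"
          by (rule continuous_on_ln_one_plus_norm[OF hol])
        then show "continuous_on (ball 0 1) u"
          unfolding u_def using holomorphic_on_imp_continuous_on[OF F(1)]
          by (intro continuous_on_add continuous_on_Re continuous_on_minus)
        show "u w \<le> 0" if "w \<in> disc_union \<Lambda> \<phi>" for w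
        proof -
          have "norm w < 1" using that by (auto simp: disc_union_def ph_disc_def)
          then show ?thesis using F(2)[of w] h(2) that by (auto simp: u_def)
        qed
        show "u w \<le> ln (1 + norm (f w))" if "norm w < 1" for w
          using F(2,3)[OF that] by (simp add: u_def)
      qed (use B div z in auto)
      then show ?thesis using F(2)[of z] z by (simp add: u_def)
    qed
    then show ?thesis
      unfolding Nev_def Nev_on_def by (intro Inf_superset_mono) auto
  qed
  have "Nev f \<le> Nev_on f (disc_union \<Lambda> \<phi>) + ereal 1" if "f \<in> nevanlinna" for f
    using Nev_le[OF that] by (intro add_increasing2) auto
  then show ?thesis
    unfolding sampling_nevanlinna_def by (intro exI[of _ 1]) auto
qed

section \<open>The half-plane model\<close>

text \<open>The conformal map onto the right half-plane that sends the boundary point \<open>1\<close> to infinity; its real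
part is the Poisson kernel at \<open>1\<close>.\<close>

definition cayley :: "complex \<Rightarrow> complex" where
  "cayley z = (1 + z) / (1 - z)"

lemma cayley_denominator: "norm z < 1 \<Longrightarrow> 1 - z \<noteq> 0" for z :: complex
  by auto

lemma Re_cayley: "norm z < 1 \<Longrightarrow> Re (cayley z) = (1 - (norm z)\<^sup>2) / (norm (1 - z))\<^sup>2"
proof -
  have "Re (cayley z) = Re ((1 + z) * cnj (1 - z)) / (norm (1 - z))\<^sup>2"
    unfolding cayley_def by (subst complex_div_cnj) (simp flip: of_real_power)
  also have "Re ((1 + z) * cnj (1 - z)) = 1 - (norm z)\<^sup>2"
    unfolding cmod_power2 by (simp add: power2_eq_square algebra_simps)
  finally show ?thesis .
qed

lemma Re_cayley_pos: "norm z < 1 \<Longrightarrow> Re (cayley z) > 0"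
  using cayley_denominator[of z] by (simp add: Re_cayley abs_square_less_1)

lemma cayley_holomorphic: "cayley holomorphic_on ball 0 1"
  unfolding cayley_def[abs_def] by (intro holomorphic_intros) auto

lemma one_minus_norm_sq_cayley:
  assumes "norm z < 1"
  shows "1 - (norm z)\<^sup>2 = 4 * Re (cayley z) / (norm (1 + cayley z))\<^sup>2"
proof -
  have "1 + cayley z = 2 / (1 - z)"
    using cayley_denominator[OF assms] by (simp add: cayley_def field_simps)
  then have "(norm (1 + cayley z))\<^sup>2 = 4 / (norm (1 - z))\<^sup>2"
    by (simp add: norm_divide power_divide)
  then show ?thesis using cayley_denominator[OF assms] assms by (simp add: Re_cayley)
qed

lemma ph_dist_cayley:
  assumes "norm z < 1" "norm w < 1"
  shows "ph_dist z w = norm (cayley z - cayley w) / norm (cayley z + cnj (cayley w))"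
proof -
  have nz: "1 - z \<noteq> 0" "1 - w \<noteq> 0" "1 - cnj w \<noteq> 0" "1 - z * cnj w \<noteq> 0"
    using assms cayley_denominator[of z] cayley_denominator[of w] cayley_denominator[of "cnj w"]
      one_minus_cnj_nonzero[of w z] by (auto simp: mult.commute)
  have "cayley z - cayley w = 2 * (z - w) / ((1 - z) * (1 - w))"
    using nz by (simp add: cayley_def field_simps)
  moreover have "cayley z + cnj (cayley w) = 2 * (1 - z * cnj w) / ((1 - z) * (1 - cnj w))"
    using nz by (simp add: cayley_def field_simps)
  moreover have "norm (1 - cnj w) = norm (1 - w)"
    by (metis complex_cnj_diff complex_cnj_one complex_mod_cnj)
  ultimately have "norm (cayley z - cayley w) = 2 * norm (z - w) / (norm (1 - z) * norm (1 - w))"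
    "norm (cayley z + cnj (cayley w)) = 2 * norm (1 - z * cnj w) / (norm (1 - z) * norm (1 - w))"
    by (simp_all only: norm_divide norm_mult norm_numeral)
  then show ?thesis
    using nz unfolding ph_dist_def by (simp add: norm_divide)
qed

lemma one_minus_ph_dist_sq_cayley:
  assumes "norm z < 1" "norm w < 1"
  shows "1 - (ph_dist z w)\<^sup>2 = 4 * Re (cayley z) * Re (cayley w) / (norm (cayley z + cnj (cayley w)))\<^sup>2"
proof -
  have "Re (cayley z + cnj (cayley w)) > 0"
    using Re_cayley_pos[OF assms(1)] Re_cayley_pos[OF assms(2)] by simp
  then have "cayley z + cnj (cayley w) \<noteq> 0" by (metis less_irrefl zero_complex.sel(1))
  then have nz: "(norm (cayley z + cnj (cayley w)))\<^sup>2 \<noteq> 0" by simp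
  have "(norm (cayley z + cnj (cayley w)))\<^sup>2 - (norm (cayley z - cayley w))\<^sup>2
      = 4 * Re (cayley z) * Re (cayley w)"
    unfolding cmod_power2 by (simp add: power2_eq_square algebra_simps)
  then show ?thesis
    using nz unfolding ph_dist_cayley[OF assms] by (simp add: power_divide field_simps)
qed

text \<open>Harnack's inequality for the Poisson kernel, centred at \<open>l\<close> by a Moebius map.\<close>

lemma Re_cayley_Harnack:
  assumes "norm l < 1" "norm z < 1" "ph_dist l z \<le> c" "c < 1"
  shows "Re (cayley z) \<le> (1 + c) / (1 - c) * Re (cayley l)"
proof -
  define m where "m = Moebius_function 0 (- l)"
  have l': "norm (- l) < 1" using assms by simp
  have m1: "norm (m w) < 1" if "norm w < 1" for w
    unfolding m_def by (rule Moebius_function_norm_lt_1[OF l' that])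
  have hol: "(cayley \<circ> m) holomorphic_on ball 0 1"
    by (rule holomorphic_on_compose_gen[OF _ cayley_holomorphic])
      (use m1 Moebius_function_holomorphic[OF l'] in \<open>auto simp: m_def\<close>)
  define \<zeta> where "\<zeta> = Moebius_function 0 l z"
  have \<zeta>: "norm \<zeta> \<le> c" "norm \<zeta> < 1" "m \<zeta> = z"
    using assms Moebius_function_compose[of "- l" l z]
    by (auto simp: \<zeta>_def m_def ph_dist_eq_norm_Moebius)
  have "m 0 = l" by (simp add: m_def Moebius_function_of_zero)
  have "Re (cayley z) \<le> (1 + norm \<zeta>) / (1 - norm \<zeta>) * Re (cayley l)"
    using Harnack_at_centre(2)[OF hol _ \<zeta>(2)] Re_cayley_pos[OF m1] \<zeta>(3) \<open>m 0 = l\<close>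
    by (force simp: less_imp_le)
  also have "\<dots> \<le> (1 + c) / (1 - c) * Re (cayley l)"
    using \<zeta> assms Re_cayley_pos[OF assms(1)] order_trans[OF norm_ge_zero \<zeta>(1)]
    by (intro mult_right_mono frac_le) auto
  finally show ?thesis .
qed

text \<open>The inverse of the Cayley map on the positive real axis.\<close>

definition disc_point :: "real \<Rightarrow> complex" where
  "disc_point x = of_real ((x - 1) / (x + 1))"

lemma disc_point:
  assumes "x > 0"
  shows "norm (disc_point x) < 1" "cayley (disc_point x) = of_real x"
proof -
  show "norm (disc_point x) < 1"
    using assms unfolding disc_point_def norm_of_real by (simp add: abs_less_iff field_simps)
  have "1 - (x - 1) / (x + 1) = 2 / (x + 1)" "1 + (x - 1) / (x + 1) = 2 * x / (x + 1)"
    using assms by (auto simp: field_simps)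
  then have "(1 + (x - 1) / (x + 1)) / (1 - (x - 1) / (x + 1)) = x"
    using assms by simp
  moreover have cayley_of_real: "cayley (of_real r) = of_real ((1 + r) / (1 - r))" for r
    by (simp add: cayley_def)
  ultimately show "cayley (disc_point x) = of_real x"
    unfolding disc_point_def using cayley_of_real by metis
qed

section \<open>Separated sets in the half-plane\<close>

lemma ph_dist_disc_point_le:
  assumes "x > 0" "norm l < 1" "\<tau> \<le> 1 / 2" "ph_dist l (disc_point x) < \<tau>"
  shows "norm (cayley l - of_real x) \<le> 4 * \<tau> * x"
proof -
  let ?w = "cayley l"
  have p: "Re ?w > 0" by (rule Re_cayley_pos[OF assms(2)])
  have "norm (?w + of_real x) > 0" using p assms(1) by (auto simp: complex_eq_iff)
  moreover have "norm (?w - of_real x) / norm (?w + of_real x) < \<tau>"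
    using assms(4) ph_dist_cayley[OF assms(2) disc_point(1)[OF assms(1)]] disc_point(2)[OF assms(1)] by simp
  ultimately have "norm (?w - of_real x) < \<tau> * norm (?w + of_real x)"
    by (simp add: field_simps)
  moreover have "\<tau> > 0" by (rule le_less_trans[OF _ assms(4)]) (simp add: ph_dist_def)
  moreover have "norm (?w + of_real x) \<le> norm (?w - of_real x) + 2 * x"
    using norm_triangle_ineq[of "?w - of_real x" "2 * of_real x"] assms(1)
    by (simp add: norm_mult add.commute)
  ultimately have "norm (?w - of_real x) < \<tau> * (norm (?w - of_real x) + 2 * x)"
    by (smt (verit) mult_left_mono)
  also have "\<dots> = \<tau> * norm (?w - of_real x) + 2 * \<tau> * x" by (simp add: algebra_simps)
  also have "\<tau> * norm (?w - of_real x) \<le> 1 / 2 * norm (?w - of_real x)"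
    using assms(3) by (intro mult_right_mono) auto
  finally show ?thesis by simp
qed

text \<open>The points with half-plane coordinates \<open>X\<close> and \<open>X * (1 + \<delta>)\<close> cannot both have a point of \<open>\<Lambda>\<close> nearby.
The same \<open>l\<close> cannot be close to both, because they are too far apart; two different ones would be closer
to each other than \<open>\<delta>\<close>.\<close>

lemma separated_avoids_radial_points:
  assumes \<Lambda>: "\<Lambda> \<subseteq> ball 0 1" and \<delta>: "0 < \<delta>" "\<delta> \<le> 1"
    and sep: "\<And>z w. z \<in> \<Lambda> \<Longrightarrow> w \<in> \<Lambda> \<Longrightarrow> z \<noteq> w \<Longrightarrow> \<delta> \<le> ph_dist z w"
    and X: "X > 0"
  shows "\<exists>x\<ge>X. \<forall>l\<in>\<Lambda>. \<delta> / 16 \<le> ph_dist l (disc_point x)"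
proof (rule ccontr)
  assume "\<not> ?thesis"
  then have none: "\<exists>l\<in>\<Lambda>. ph_dist l (disc_point x) < \<delta> / 16" if "x \<ge> X" for x
    using that by (meson not_le)
  define Y where "Y = X * (1 + \<delta>)"
  have Y: "Y \<ge> X" "Y > 0" using X \<delta> by (auto simp: Y_def)
  obtain l where l: "l \<in> \<Lambda>" "ph_dist l (disc_point X) < \<delta> / 16"
    using none by blast
  obtain l' where l': "l' \<in> \<Lambda>" "ph_dist l' (disc_point Y) < \<delta> / 16"
    using none[OF Y(1)] by blast
  have n: "norm l < 1" "norm l' < 1" using l l' \<Lambda> by auto
  have a: "norm (cayley l - of_real X) \<le> \<delta> / 4 * X"
    using ph_dist_disc_point_le[OF X n(1) _ l(2)] \<delta> by simp
  have b: "norm (cayley l' - of_real Y) \<le> \<delta> / 4 * Y"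
    using ph_dist_disc_point_le[OF Y(2) n(2) _ l'(2)] \<delta> by simp
  have sum: "\<delta> / 4 * X + \<delta> / 4 * Y \<le> 3 / 4 * (\<delta> * X)"
  proof -
    have "\<delta> * (\<delta> * X) \<le> 1 * (\<delta> * X)" using \<delta> X by (intro mult_right_mono) auto
    then show ?thesis by (simp add: Y_def algebra_simps)
  qed
  have YX: "Y - X = \<delta> * X" by (simp add: Y_def algebra_simps)
  have \<delta>X: "0 < \<delta> * X" "\<delta> * X \<le> X" using \<delta> X by auto
  show False
  proof (cases "l = l'")
    case True
    have "norm (of_real Y - of_real X :: complex) \<le> norm (cayley l - of_real X) + norm (cayley l' - of_real Y)"
      using norm_triangle_ineq4[of "cayley l - of_real X" "cayley l' - of_real Y"] True by simp
    moreover have "norm (of_real Y - of_real X :: complex) = \<delta> * X"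
      using \<delta>X by (simp add: YX[symmetric] flip: of_real_diff)
    ultimately show False using a b sum \<delta>X by linarith
  next
    case False
    have up: "norm (cayley l' - cayley l) \<le> 7 / 4 * (\<delta> * X)"
    proof -
      have "norm (cayley l' - cayley l) \<le> norm (cayley l' - of_real Y) + norm (of_real Y - of_real X :: complex)
          + norm (of_real X - cayley l)"
        by (smt (verit) norm_diff_triangle_ineq norm_triangle_ineq diff_add_cancel add_diff_eq)
      moreover have "norm (of_real Y - of_real X :: complex) = \<delta> * X"
        using \<delta>X by (simp add: YX[symmetric] flip: of_real_diff)
      ultimately show ?thesis
        using a b sum norm_minus_commute[of "of_real X" "cayley l"] by linarith
    qed
    have "Re (cayley l) \<ge> X - \<delta> / 4 * X"
      using abs_Re_le_cmod[of "cayley l - of_real X"] a by simp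
    moreover have "Re (cayley l') \<ge> Y - \<delta> / 4 * Y"
      using abs_Re_le_cmod[of "cayley l' - of_real Y"] b by simp
    ultimately have "2 * X \<le> Re (cayley l') + Re (cayley l)"
      using sum YX \<delta>X by linarith
    then have "Re (cayley l' + cnj (cayley l)) \<ge> 2 * X" by simp
    then have lo: "norm (cayley l' + cnj (cayley l)) \<ge> 2 * X"
      using complex_Re_le_cmod order_trans by blast
    have "\<delta> \<le> norm (cayley l' - cayley l) / norm (cayley l' + cnj (cayley l))"
      using sep[OF l'(1) l(1)] False ph_dist_cayley[OF n(2,1)] by auto
    then have "\<delta> * norm (cayley l' + cnj (cayley l)) \<le> norm (cayley l' - cayley l)"
      using lo X pos_le_divide_eq[of "norm (cayley l' + cnj (cayley l))" \<delta> "norm (cayley l' - cayley l)"]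
      by linarith
    moreover have "\<delta> * (2 * X) \<le> \<delta> * norm (cayley l' + cnj (cayley l))"
      using lo \<delta> by (intro mult_left_mono) auto
    ultimately show False using up \<delta>X by simp
  qed
qed

text \<open>A cell \<open>s \<le> Re w < Q * s\<close>, \<open>\<delta> * s * b \<le> Im w < \<delta> * s * (b + 1)\<close> with an integer \<open>b\<close> has
pseudohyperbolic diameter less than \<open>\<delta> = Q - 1\<close>, hence contains at most one point of the set. The
heights are \<open>s = Q ^ i / Q ^ d\<close>, where the offset \<open>d\<close> makes the index \<open>i\<close> a natural number for all points
with \<open>Re w \<ge> 1 / M\<close>. The integer \<open>b\<close> is encoded by its sign and a natural number \<open>k\<close> that bounds \<open>\<bar>Im w\<bar>\<close>
from below: \<open>k = b\<close> or \<open>k = - b - 1\<close>.\<close>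

lemma separated_grid_index:
  assumes \<Lambda>: "\<Lambda> \<subseteq> ball 0 1" and \<delta>: "0 < \<delta>"
    and sep: "\<And>z w. z \<in> \<Lambda> \<Longrightarrow> w \<in> \<Lambda> \<Longrightarrow> z \<noteq> w \<Longrightarrow> \<delta> \<le> ph_dist z w"
    and M: "M > 0" and Q: "Q = 1 + \<delta>" "M \<le> Q ^ d"
    and A: "A = {z\<in>\<Lambda>. 1 \<le> M * Re (cayley z)}"
  obtains i k :: "complex \<Rightarrow> nat" and s :: "complex \<Rightarrow> bool" where
    "inj_on (\<lambda>z. (i z, k z, s z)) A"
    "\<And>z. z \<in> A \<Longrightarrow> Q ^ i z / Q ^ d \<le> Re (cayley z)"
    "\<And>z. z \<in> A \<Longrightarrow> Re (cayley z) < Q * (Q ^ i z / Q ^ d)"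
    "\<And>z. z \<in> A \<Longrightarrow> \<delta> * real (k z) * (Q ^ i z / Q ^ d) \<le> \<bar>Im (cayley z)\<bar>"
proof -
  have Q1: "Q > 1" using Q \<delta> by simp
  have "\<exists>n. Q ^ n / Q ^ d \<le> Re (cayley z) \<and> Re (cayley z) < Q * (Q ^ n / Q ^ d)" if z: "z \<in> A" for z
  proof -
    define y where "y = Re (cayley z) * Q ^ d"
    have "norm z < 1" using z A \<Lambda> by auto
    then have pos: "Re (cayley z) > 0" by (rule Re_cayley_pos)
    have "1 \<le> M * Re (cayley z)" using z A by simp
    also have "\<dots> \<le> y" unfolding y_def using Q(2) pos by (simp add: mult.commute mult_left_mono)
    finally have y: "y \<ge> 1" .
    then have "1 / y \<in> {0<..1}" by simp
    also have "\<dots> = (\<Union>m. {(1 / Q) ^ Suc m<..(1 / Q) ^ m})"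
      using geometric_shells(2)[of "1 / Q"] Q1 by simp
    finally obtain n where "(1 / Q) ^ Suc n < 1 / y" "1 / y \<le> (1 / Q) ^ n" by auto
    then have "Q ^ n \<le> y" "y < Q * Q ^ n"
      using y Q1 by (auto simp: field_simps)
    then show ?thesis using Q1 by (intro exI[of _ n]) (auto simp: y_def field_simps)
  qed
  then obtain i where i: "\<And>z. z \<in> A \<Longrightarrow> Q ^ i z / Q ^ d \<le> Re (cayley z)"
    "\<And>z. z \<in> A \<Longrightarrow> Re (cayley z) < Q * (Q ^ i z / Q ^ d)" by metis
  define sc where "sc = (\<lambda>z. Q ^ i z / Q ^ d)"
  have sc: "sc z > 0" for z using Q1 by (simp add: sc_def)
  define b where "b = (\<lambda>z. \<lfloor>Im (cayley z) / (\<delta> * sc z)\<rfloor>)"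
  define s where "s = (\<lambda>z. b z \<ge> 0)"
  define k where "k = (\<lambda>z. if b z \<ge> 0 then nat (b z) else nat (- b z - 1))"
  have bd: "of_int (b z) * (\<delta> * sc z) \<le> Im (cayley z)" "Im (cayley z) < (of_int (b z) + 1) * (\<delta> * sc z)" for z
  proof -
    have p: "\<delta> * sc z > 0" using sc[of z] \<delta> by simp
    show "of_int (b z) * (\<delta> * sc z) \<le> Im (cayley z)"
      using of_int_floor_le[of "Im (cayley z) / (\<delta> * sc z)"] unfolding pos_le_divide_eq[OF p] b_def .
    show "Im (cayley z) < (of_int (b z) + 1) * (\<delta> * sc z)"
      using real_of_int_floor_add_one_gt[of "Im (cayley z) / (\<delta> * sc z)"]
      unfolding pos_divide_less_eq[OF p] b_def .
  qed
  show thesis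
  proof (rule that[of i k s])
    show "\<delta> * real (k z) * (Q ^ i z / Q ^ d) \<le> \<bar>Im (cayley z)\<bar>" if "z \<in> A" for z
    proof (cases "b z \<ge> 0")
      case True
      then have "real (k z) = of_int (b z)" by (simp add: k_def)
      then show ?thesis using bd(1)[of z] by (simp add: sc_def mult_ac)
    next
      case False
      then have "real (k z) = - of_int (b z) - 1" by (simp add: k_def)
      then have k: "real (k z) * (\<delta> * sc z) = - ((of_int (b z) + 1) * (\<delta> * sc z))"
        by (simp only: mult_minus_left[symmetric]) simp
      have "real (k z) * (\<delta> * sc z) \<le> - Im (cayley z)"
        unfolding k using bd(2)[of z] by linarith
      then show ?thesis by (simp add: sc_def mult_ac)
    qed
    show "inj_on (\<lambda>z. (i z, k z, s z)) A"
    proof (rule inj_onI)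
      fix z w assume zw: "z \<in> A" "w \<in> A" "(i z, k z, s z) = (i w, k w, s w)"
      then have sceq: "sc z = sc w" and beq: "b z = b w"
        by (auto simp: sc_def s_def k_def split: if_splits)
      have n: "norm z < 1" "norm w < 1" "z \<in> \<Lambda>" "w \<in> \<Lambda>" using zw A \<Lambda> by auto
      have sc_eq: "Q ^ i z / Q ^ d = sc z" and Q_sc: "Q * sc z = sc z + \<delta> * sc z" for z
        by (simp_all add: sc_def) (simp add: Q algebra_simps add_divide_distrib)
      have re: "sc z \<le> Re (cayley z)" "Re (cayley z) < sc z + \<delta> * sc z"
        "sc z \<le> Re (cayley w)" "Re (cayley w) < sc z + \<delta> * sc z"
        using i[OF zw(1)] i[OF zw(2)] unfolding sc_eq sceq Q_sc by auto
      have im: "\<bar>Im (cayley z - cayley w)\<bar> < \<delta> * sc z"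
        using bd[of z] bd[of w] beq sceq by (auto simp: algebra_simps abs_less_iff)
      have "norm (cayley z - cayley w) < 2 * (\<delta> * sc z)"
        using cmod_le[of "cayley z - cayley w"] im re by auto
      moreover have "2 * sc z \<le> norm (cayley z + cnj (cayley w))"
        using complex_Re_le_cmod[of "cayley z + cnj (cayley w)"] re by simp
      moreover then have "\<delta> * (2 * sc z) \<le> \<delta> * norm (cayley z + cnj (cayley w))"
        using \<delta> by (intro mult_left_mono) auto
      ultimately have "norm (cayley z - cayley w) < \<delta> * norm (cayley z + cnj (cayley w))"
        "norm (cayley z + cnj (cayley w)) > 0" using sc[of z] by (auto simp del: zero_less_norm_iff)
      then have "ph_dist z w < \<delta>"
        unfolding ph_dist_cayley[OF n(1,2)] by (subst pos_divide_less_eq) (auto simp del: zero_less_norm_iff)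
      then show "z = w" using sep[OF n(3,4)] by force
    qed
  qed (use i in auto)
qed

lemma sum_le_of_grid_index:
  fixes \<alpha> \<beta> :: "nat \<Rightarrow> real"
  assumes inj: "inj_on (\<lambda>z. (i z, k z, s z :: bool)) A"
    and t: "\<And>z. z \<in> A \<Longrightarrow> t z \<le> \<alpha> (i z) * \<beta> (k z)"
    and \<alpha>: "\<And>n. \<alpha> n \<ge> 0" "summable \<alpha>" and \<beta>: "\<And>n. \<beta> n \<ge> 0" "summable \<beta>"
    and F: "finite F" "F \<subseteq> A"
  shows "sum t F \<le> 2 * (suminf \<alpha> * suminf \<beta>)"
proof -
  obtain N where N: "i ` F \<subseteq> {..<N}" "k ` F \<subseteq> {..<N}"
    using finite_subset_image
    by (metis F(1) finite_imageI finite_nat_bounded finite_UnI Un_subset_iff)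
  have "sum t F \<le> (\<Sum>z\<in>F. \<alpha> (i z) * \<beta> (k z))"
    using t F by (intro sum_mono) auto
  also have "\<dots> = (\<Sum>(n, m, b)\<in>(\<lambda>z. (i z, k z, s z)) ` F. \<alpha> n * \<beta> m)"
    using inj F by (subst sum.reindex) (auto simp: inj_on_subset)
  also have "\<dots> \<le> (\<Sum>(n, m, b)\<in>{..<N} \<times> {..<N} \<times> (UNIV :: bool set). \<alpha> n * \<beta> m)"
    using N \<alpha>(1) \<beta>(1) by (intro sum_mono2) auto
  also have "\<dots> = (\<Sum>n<N. \<Sum>m<N. 2 * (\<alpha> n * \<beta> m))"
    by (simp add: sum.cartesian_product[symmetric] mult_ac)
  also have "\<dots> = 2 * (sum \<alpha> {..<N} * sum \<beta> {..<N})"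
    unfolding sum_product by (simp only: sum_distrib_left)
  also have "\<dots> \<le> 2 * (suminf \<alpha> * suminf \<beta>)"
    by (intro mult_left_mono mult_mono sum_le_suminf \<alpha> \<beta> sum_nonneg suminf_nonneg) auto
  finally show ?thesis .
qed

section \<open>Sums over the zeros\<close>

lemma summable_inverse_one_plus_square:
  assumes "\<delta> > 0"
  shows "summable (\<lambda>k::nat. 1 / (1 + (\<delta> * real k)\<^sup>2))"
proof (rule summable_comparison_test)
  have "summable (\<lambda>k::nat. inverse ((real k)\<^sup>2))"
    using inverse_power_summable[of 2, where ?'a = real] by simp
  then show "summable (\<lambda>k::nat. 1 / \<delta>\<^sup>2 * inverse ((real k)\<^sup>2))" by (rule summable_mult)
  show "\<exists>N. \<forall>k\<ge>N. norm (1 / (1 + (\<delta> * real k)\<^sup>2)) \<le> 1 / \<delta>\<^sup>2 * inverse ((real k)\<^sup>2)"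
  proof (intro exI[of _ 1] allI impI)
    fix k :: nat assume "1 \<le> k"
    then have p: "0 < (\<delta> * real k)\<^sup>2" using assms by simp
    then have "0 < 1 / (1 + (\<delta> * real k)\<^sup>2)" by (intro divide_pos_pos add_pos_pos) auto
    then have "norm (1 / (1 + (\<delta> * real k)\<^sup>2)) = 1 / (1 + (\<delta> * real k)\<^sup>2)"
      by (simp only: real_norm_def abs_of_pos)
    also have "\<dots> \<le> 1 / (\<delta> * real k)\<^sup>2" using p by (intro divide_left_mono mult_pos_pos add_pos_pos) auto
    also have "\<dots> = 1 / \<delta>\<^sup>2 * inverse ((real k)\<^sup>2)"
      by (simp add: power_mult_distrib field_simps)
    finally show "norm (1 / (1 + (\<delta> * real k)\<^sup>2)) \<le> 1 / \<delta>\<^sup>2 * inverse ((real k)\<^sup>2)" .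
  qed
qed

text \<open>The Blaschke condition in half-plane coordinates. For a point in the cell with indices \<open>i\<close>, \<open>k\<close> and height \<open>\<sigma>\<close>,
\<open>\<bar>1 + w\<bar>\<^sup>2\<close> is at least \<open>\<sigma>\<^sup>2 * (1 + (\<delta> * k)\<^sup>2)\<close>. The main part of \<open>m l\<close> therefore contributes a term of the
convergent series in \<open>i\<close>, and the rounding error \<open>1\<close> contributes \<open>1 / \<sigma>\<close>, a geometric series; both carry the
summable factor \<open>1 / (1 + (\<delta> * k)\<^sup>2)\<close>.\<close>

lemma blaschke_weights_bounded:
  fixes \<phi> :: "real \<Rightarrow> real"
  assumes \<Lambda>: "\<Lambda> \<subseteq> ball 0 1" and \<delta>: "0 < \<delta>"
    and sep: "\<And>z w. z \<in> \<Lambda> \<Longrightarrow> w \<in> \<Lambda> \<Longrightarrow> z \<noteq> w \<Longrightarrow> \<delta> \<le> ph_dist z w"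
    and \<phi>: "\<And>t. t \<in> {0<..1} \<Longrightarrow> \<phi> t \<in> {0<..<1}" "mono_on {0<..1} \<phi>"
    and conv: "\<And>q. 0 < q \<Longrightarrow> q < 1 \<Longrightarrow> summable (\<lambda>n. 1 / ln (1 / \<phi> (q ^ n)))"
    and M: "M > 0" and K: "K \<ge> 0"
    and A: "A = {z\<in>\<Lambda>. 1 \<le> M * Re (cayley z)}"
    and m: "\<And>l. l \<in> A \<Longrightarrow> real (m l) \<le> K * Re (cayley l) / ln (1 / \<phi> (1 - norm l)) + 1"
  shows "countable A"
    and "\<exists>S. \<forall>F. finite F \<longrightarrow> F \<subseteq> A \<longrightarrow> (\<Sum>l\<in>F. m l * Re (cayley l) / (norm (1 + cayley l))\<^sup>2) \<le> S"
proof -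
  define Q where "Q = 1 + \<delta>"
  have Q: "Q > 1" using \<delta> by (simp add: Q_def)
  obtain d where d: "M \<le> Q ^ d" using real_arch_pow[OF Q, of M] less_imp_le by blast
  obtain i k s where inj: "inj_on (\<lambda>z. (i z, k z, s z :: bool)) A"
    and lo: "\<And>z. z \<in> A \<Longrightarrow> Q ^ i z / Q ^ d \<le> Re (cayley z)"
    and hi: "\<And>z. z \<in> A \<Longrightarrow> Re (cayley z) < Q * (Q ^ i z / Q ^ d)"
    and im: "\<And>z. z \<in> A \<Longrightarrow> \<delta> * real (k z) * (Q ^ i z / Q ^ d) \<le> \<bar>Im (cayley z)\<bar>"
    using separated_grid_index[OF \<Lambda> \<delta> sep M Q_def d A] by blast
  show "countable A" using inj by (rule countableI')
  define g where "g = (\<lambda>t. 1 / ln (1 / \<phi> t))"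
  have lnpos: "ln (1 / \<phi> t) > 0" if "t \<in> {0<..1}" for t
    using \<phi>(1)[OF that] by simp
  have gmono: "g s \<le> g t" if "s \<in> {0<..1}" "t \<in> {0<..1}" "s \<le> t" for s t
  proof -
    have "\<phi> s \<le> \<phi> t" using mono_onD[OF \<phi>(2)] that by blast
    then show ?thesis
      unfolding g_def using \<phi>(1)[OF that(1)] \<phi>(1)[OF that(2)]
      by (intro reciprocal_log_mono) auto
  qed
  have gnn: "0 \<le> g t" if "t \<in> {0<..1}" for t using lnpos[OF that] by (simp add: g_def)
  \<comment> \<open>A shift by \<open>D\<close> absorbs the constants in the comparison of \<open>1 - norm l\<close> with the height of a cell.\<close>
  obtain D where D: "4 * Q * Q ^ d \<le> Q ^ D" using real_arch_pow[OF Q] less_imp_le by blast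
  define q where "q = 1 / Q"
  have q: "0 < q" "q < 1" using Q by (auto simp: q_def)
  have qn: "q ^ n \<in> {0<..1}" for n using q by (auto simp: power_le_one)
  define \<alpha> where "\<alpha> = (\<lambda>n. K * Q\<^sup>2 * g (q ^ (n - D)) + Q * Q ^ d * q ^ n)"
  define \<beta> where "\<beta> = (\<lambda>k::nat. 1 / (1 + (\<delta> * real k)\<^sup>2))"
  have \<beta>: "\<And>n. \<beta> n \<ge> 0" "summable \<beta>"
    using summable_inverse_one_plus_square[OF \<delta>] by (auto simp: \<beta>_def)
  have \<alpha>0: "\<alpha> n \<ge> 0" for n using gnn[OF qn] K Q q by (simp add: \<alpha>_def)
  have \<alpha>: "summable \<alpha>"
  proof -
    have "summable (\<lambda>n. g (q ^ n))" using conv[OF q] by (simp add: g_def)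
    then have "summable (\<lambda>n. (\<lambda>n. g (q ^ (n - D))) (n + D))" by simp
    then have "summable (\<lambda>n. g (q ^ (n - D)))" by (subst (asm) summable_iff_shift)
    then show ?thesis
      unfolding \<alpha>_def using q by (intro summable_add summable_mult summable_geometric) auto
  qed
  have weight_le: "m l * Re (cayley l) / (norm (1 + cayley l))\<^sup>2 \<le> \<alpha> (i l) * \<beta> (k l)" if l: "l \<in> A" for l
  proof -
    define a where "a = Re (cayley l)"
    define \<sigma> where "\<sigma> = Q ^ i l / Q ^ d"
    define N where "N = (norm (1 + cayley l))\<^sup>2"
    have \<sigma>: "\<sigma> > 0" using Q by (simp add: \<sigma>_def)
    have a: "\<sigma> \<le> a" "a < Q * \<sigma>" using lo[OF l] hi[OF l] by (auto simp: a_def \<sigma>_def)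
    have l1: "norm l < 1" using l A \<Lambda> by auto
    have N: "\<sigma>\<^sup>2 * (1 + (\<delta> * real (k l))\<^sup>2) \<le> N"
    proof -
      have "\<sigma>\<^sup>2 \<le> (1 + a)\<^sup>2" using a \<sigma> by (intro power_mono) auto
      moreover have "(\<delta> * real (k l) * \<sigma>)\<^sup>2 \<le> \<bar>Im (cayley l)\<bar>\<^sup>2"
        using im[OF l, folded \<sigma>_def] \<delta> \<sigma> by (intro power_mono) auto
      ultimately show ?thesis
        unfolding N_def cmod_power2 by (simp add: a_def power_mult_distrib algebra_simps)
    qed
    have \<sigma>2: "0 < \<sigma>\<^sup>2 * (1 + (\<delta> * real (k l))\<^sup>2)"
      using \<sigma> by (intro mult_pos_pos add_pos_nonneg) auto
    then have Npos: "N > 0" using N by linarith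
    have inv: "1 / N \<le> \<beta> (k l) / \<sigma>\<^sup>2"
    proof -
      have "1 / N \<le> 1 / (\<sigma>\<^sup>2 * (1 + (\<delta> * real (k l))\<^sup>2))"
        using N \<sigma>2 Npos by (intro divide_left_mono) auto
      then show ?thesis by (simp add: \<beta>_def mult.commute)
    qed
    have inv2: "1 / N \<le> 1 / \<sigma>\<^sup>2"
    proof -
      have "\<beta> (k l) \<le> 1" by (simp add: \<beta>_def add_pos_nonneg)
      then have "\<beta> (k l) / \<sigma>\<^sup>2 \<le> 1 / \<sigma>\<^sup>2" by (intro divide_right_mono) auto
      then show ?thesis using inv by linarith
    qed
    have inv\<sigma>: "1 / \<sigma> = Q ^ d * q ^ i l"
      using Q by (simp add: \<sigma>_def q_def power_one_over)
    \<comment> \<open>The height of a grid cell bounds the distance to the circle, so \<open>\<phi>\<close> can be evaluated at a power of \<open>q\<close>.\<close>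
    have height: "1 - norm l \<le> 4 * Q * Q ^ d * q ^ i l"
    proof -
      have "(norm l)\<^sup>2 \<le> norm l * 1"
        unfolding power2_eq_square using l1 by (intro mult_left_mono) auto
      then have "1 - norm l \<le> 1 - (norm l)\<^sup>2" by simp
      also have "\<dots> = 4 * a * (1 / N)" using one_minus_norm_sq_cayley[OF l1] by (simp add: a_def N_def)
      also have "\<dots> \<le> 4 * (Q * \<sigma>) * (1 / \<sigma>\<^sup>2)"
        using a inv2 \<sigma> Npos Q by (intro mult_mono) auto
      also have "\<dots> = 4 * Q * (1 / \<sigma>)" using \<sigma> by (simp add: power2_eq_square)
      finally show ?thesis by (simp add: inv\<sigma>)
    qed
    have gle: "g (1 - norm l) \<le> g (q ^ (i l - D))"
    proof (rule gmono)
      have nn: "0 \<le> norm l" by simp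
      then show "1 - norm l \<in> {0<..1}" using l1 by auto
      show "q ^ (i l - D) \<in> {0<..1}" by (rule qn)
      show "1 - norm l \<le> q ^ (i l - D)"
      proof (cases "i l \<ge> D")
        case True
        have "1 - norm l \<le> Q ^ D * q ^ i l"
          by (rule order_trans[OF height mult_right_mono[OF D]]) (use q in simp)
        also have "\<dots> = q ^ (i l - D)"
          using True Q by (simp add: q_def power_one_over power_diff)
        finally show ?thesis .
      qed (use nn in simp)
    qed
    have "m l * a * (1 / N) \<le> (K * a * g (1 - norm l) + 1) * a * (1 / N)"
      using m[OF l] a \<sigma> Npos by (intro mult_right_mono) (auto simp: a_def g_def)
    also have "\<dots> \<le> (K * (Q * \<sigma>) * g (q ^ (i l - D)) + 1) * (Q * \<sigma>) * (\<beta> (k l) / \<sigma>\<^sup>2)"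
      using a \<sigma> Npos inv K Q gle gnn[OF qn] gnn[of "1 - norm l"] l1
      by (intro mult_mono add_mono mult_nonneg_nonneg add_nonneg_nonneg order_refl) auto
    also have "\<dots> = (K * Q\<^sup>2 * g (q ^ (i l - D)) + Q * (1 / \<sigma>)) * \<beta> (k l)"
      using \<sigma> by (simp add: field_simps power2_eq_square)
    also have "\<dots> = \<alpha> (i l) * \<beta> (k l)" unfolding inv\<sigma> \<alpha>_def by (simp add: mult.assoc)
    finally show ?thesis by (simp add: a_def N_def)
  qed
  show "\<exists>S. \<forall>F. finite F \<longrightarrow> F \<subseteq> A \<longrightarrow> (\<Sum>l\<in>F. m l * Re (cayley l) / (norm (1 + cayley l))\<^sup>2) \<le> S"
    using sum_le_of_grid_index[OF inj weight_le \<alpha>0 \<alpha> \<beta>] by blast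
qed

text \<open>Dominated convergence for \<open>x\<close> tending to infinity, in terms of finite sums: the tail outside a suitable
finite set \<open>F0\<close> is small for \<open>x = 1\<close> and decreases in \<open>x\<close>, and the terms in \<open>F0\<close> are at most a constant
over \<open>x\<^sup>2\<close>.\<close>

lemma shifted_sums_small:
  fixes m :: "'a \<Rightarrow> real" and w :: "'a \<Rightarrow> complex"
  assumes m: "\<And>l. l \<in> A \<Longrightarrow> 0 \<le> m l" and w: "\<And>l. l \<in> A \<Longrightarrow> Re (w l) > 0"
    and S: "\<And>F. finite F \<Longrightarrow> F \<subseteq> A \<Longrightarrow> (\<Sum>l\<in>F. m l * Re (w l) / (norm (1 + w l))\<^sup>2) \<le> S"
    and e: "e > 0"
  shows "\<exists>X\<ge>1. \<forall>x\<ge>X. \<forall>F. finite F \<longrightarrow> F \<subseteq> A \<longrightarrow>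
    (\<Sum>l\<in>F. m l * Re (w l) / (norm (of_real x + w l))\<^sup>2) \<le> e"
proof -
  define t where "t = (\<lambda>l. m l * Re (w l) / (norm (1 + w l))\<^sup>2)"
  define T where "T = (\<lambda>F. sum t F) ` {F. finite F \<and> F \<subseteq> A}"
  have T: "T \<noteq> {}" "bdd_above T"
    using S by (auto simp: T_def t_def intro!: bdd_aboveI2[of _ _ S])
  obtain F0 where F0: "finite F0" "F0 \<subseteq> A" "Sup T - e / 2 < sum t F0"
  proof -
    have "Sup T - e / 2 < Sup T" using e by simp
    then have "\<exists>y\<in>T. Sup T - e / 2 < y" using less_cSup_iff[OF T] by blast
    then show thesis using that by (auto simp: T_def)
  qed
  define s where "s = (\<Sum>l\<in>F0. m l * Re (w l))"
  have s: "s \<ge> 0" unfolding s_def using m w F0 by (intro sum_nonneg mult_nonneg_nonneg) (auto intro: less_imp_le)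
  define X where "X = max 1 (2 * s / e)"
  show ?thesis
  proof (intro exI[of _ X] conjI allI impI)
    show "X \<ge> 1" by (simp add: X_def)
    fix x F assume x: "x \<ge> X" and F: "finite F" "F \<subseteq> A"
    have x1: "x \<ge> 1" "2 * s \<le> e * x" using x e by (auto simp: X_def field_simps)
    define tx where "tx = (\<lambda>l. m l * Re (w l) / (norm (of_real x + w l))\<^sup>2)"
    have sq: "(norm (1 + w l))\<^sup>2 \<le> (norm (of_real x + w l))\<^sup>2" "x\<^sup>2 \<le> (norm (of_real x + w l))\<^sup>2"
      "0 < (norm (1 + w l))\<^sup>2" if "l \<in> A" for l
    proof -
      have "(1 + Re (w l))\<^sup>2 \<le> (x + Re (w l))\<^sup>2" "x\<^sup>2 \<le> (x + Re (w l))\<^sup>2" "0 < (1 + Re (w l))\<^sup>2"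
        using w[OF that] x1 by (auto intro!: power_mono)
      then show "(norm (1 + w l))\<^sup>2 \<le> (norm (of_real x + w l))\<^sup>2" "x\<^sup>2 \<le> (norm (of_real x + w l))\<^sup>2"
        "0 < (norm (1 + w l))\<^sup>2"
        unfolding cmod_power2 by (auto intro: add_pos_nonneg add_increasing2)
    qed
    have tx1: "tx l \<le> t l" if "l \<in> A" for l
      unfolding tx_def t_def using m[OF that] w[OF that]
      by (intro divide_left_mono mult_pos_pos mult_nonneg_nonneg sq[OF that]
          order_less_le_trans[OF sq(3)[OF that] sq(1)[OF that]]) auto
    have tx2: "tx l \<le> m l * Re (w l) / x\<^sup>2" if "l \<in> A" for l
      unfolding tx_def using m[OF that] w[OF that] x1
      by (intro divide_left_mono mult_pos_pos mult_nonneg_nonneg sq[OF that]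
          order_less_le_trans[OF sq(3)[OF that] sq(1)[OF that]]) auto
    have nn: "0 \<le> m l * Re (w l) / x\<^sup>2" if "l \<in> A" for l
      using m[OF that] w[OF that] by simp
    have "sum t (F - F0) + sum t F0 = sum t (F \<union> F0)"
      using F F0 by (subst sum.union_disjoint[symmetric]) auto
    also have "\<dots> \<le> Sup T"
      using F F0 by (intro cSup_upper T) (auto simp: T_def)
    finally have tail: "sum t (F - F0) < e / 2" using F0 by linarith
    have "sum tx F = sum tx (F - F0) + sum tx (F \<inter> F0)"
      using F by (metis Diff_Diff_Int add.commute inf_commute sum.Int_Diff)
    also have "sum tx (F - F0) \<le> sum t (F - F0)"
      using F by (intro sum_mono tx1) auto
    also have "sum tx (F \<inter> F0) \<le> (\<Sum>l\<in>F \<inter> F0. m l * Re (w l) / x\<^sup>2)"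
      using F by (intro sum_mono tx2) auto
    also have "\<dots> \<le> (\<Sum>l\<in>F0. m l * Re (w l) / x\<^sup>2)"
      using F0 by (intro sum_mono2 nn) auto
    also have "\<dots> = s / x\<^sup>2" by (simp add: s_def sum_divide_distrib)
    also have "\<dots> \<le> e / 2"
    proof -
      have "x * 1 \<le> x * x" using x1 by (intro mult_left_mono) auto
      then have "e * x \<le> e * x\<^sup>2" using e by (intro mult_left_mono) (auto simp: power2_eq_square)
      then show ?thesis using x1 by (simp add: field_simps)
    qed
    finally show "(\<Sum>l\<in>F. m l * Re (w l) / (norm (of_real x + w l))\<^sup>2) \<le> e"
      using tail by (simp add: tx_def)
  qed
qed

section \<open>Blaschke products\<close>

text \<open>The factors carry no unimodular normalization: only moduli matter, and convergence is obtained from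
Montel's theorem along a subsequence.\<close>

definition finite_blaschke :: "(complex \<Rightarrow> nat) \<Rightarrow> complex set \<Rightarrow> complex \<Rightarrow> complex" where
  "finite_blaschke m F z = (\<Prod>l\<in>F. Moebius_function 0 l z ^ m l)"

lemma norm_finite_blaschke: "norm (finite_blaschke m F z) = (\<Prod>l\<in>F. ph_dist l z ^ m l)"
  by (simp add: finite_blaschke_def prod_norm[symmetric] norm_power ph_dist_eq_norm_Moebius)

lemma ph_dist_nonneg: "0 \<le> ph_dist z w"
  by (simp add: ph_dist_def)

lemma ph_dist_less_1: "norm z < 1 \<Longrightarrow> norm w < 1 \<Longrightarrow> ph_dist z w < 1"
  unfolding ph_dist_eq_norm_Moebius by (rule Moebius_function_norm_lt_1)

lemma finite_blaschke_holomorphic: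
  assumes "F \<subseteq> ball 0 1"
  shows "finite_blaschke m F holomorphic_on ball 0 1"
  unfolding finite_blaschke_def[abs_def]
  using assms by (intro holomorphic_intros Moebius_function_holomorphic) auto

lemma norm_finite_blaschke_le_1:
  assumes "F \<subseteq> ball 0 1" "norm z < 1"
  shows "norm (finite_blaschke m F z) \<le> 1"
  unfolding norm_finite_blaschke using assms
  by (intro prod_le_1 conjI zero_le_power power_le_one ph_dist_nonneg less_imp_le[OF ph_dist_less_1]) auto

lemma norm_finite_blaschke_le_factor:
  assumes "F \<subseteq> ball 0 1" "norm z < 1" "finite F" "l \<in> F"
  shows "norm (finite_blaschke m F z) \<le> ph_dist l z ^ m l"
proof -
  have "norm (finite_blaschke m F z) = ph_dist l z ^ m l * norm (finite_blaschke m (F - {l}) z)"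
    unfolding norm_finite_blaschke using assms by (simp add: prod.remove)
  also have "\<dots> \<le> ph_dist l z ^ m l * 1"
    using assms by (intro mult_left_mono norm_finite_blaschke_le_1 zero_le_power ph_dist_nonneg) auto
  finally show ?thesis by simp
qed

lemma exp_neg_one_minus_square_le:
  fixes \<rho> \<tau> :: real
  assumes "0 < \<tau>" "\<tau> \<le> \<rho>" "\<rho> < 1"
  shows "exp (- (1 - \<rho>\<^sup>2) / (2 * \<tau>\<^sup>2)) \<le> \<rho>"
proof -
  have \<rho>: "\<rho> > 0" using assms by simp
  have sq: "\<rho>\<^sup>2 \<le> 1" using assms by (simp add: abs_square_le_1)
  have "- 2 * ln \<rho> = ln (1 / \<rho>\<^sup>2)" using \<rho> by (simp add: ln_div ln_realpow)
  also have "\<dots> \<le> 1 / \<rho>\<^sup>2 - 1" using \<rho> by (intro ln_le_minus_one) simp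
  also have "\<dots> = (1 - \<rho>\<^sup>2) / \<rho>\<^sup>2" using \<rho> by (simp add: field_simps)
  also have "\<dots> \<le> (1 - \<rho>\<^sup>2) / \<tau>\<^sup>2"
    using assms \<rho> sq by (intro divide_left_mono power_mono mult_pos_pos) auto
  finally have le: "- 2 * ln \<rho> \<le> (1 - \<rho>\<^sup>2) / \<tau>\<^sup>2" .
  have "- y / 2 \<le> a" if "- 2 * a \<le> y" for a y :: real using that by simp
  from this[OF le] have "- (1 - \<rho>\<^sup>2) / (2 * \<tau>\<^sup>2) \<le> ln \<rho>"
    by (simp only: minus_divide_left divide_divide_eq_left mult.commute)
  then show ?thesis using \<rho> by (metis exp_le_cancel_iff exp_ln)
qed

text \<open>Away from the zeros, \<open>- ln \<rho>\<close> is at most a multiple of \<open>1 - \<rho>\<^sup>2\<close>, and in half-plane coordinates the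
latter is an explicit kernel that can be summed.\<close>

lemma norm_finite_blaschke_ge:
  assumes "F \<subseteq> ball 0 1" "norm z < 1" "0 < \<tau>" "\<And>l. l \<in> F \<Longrightarrow> \<tau> \<le> ph_dist l z"
  shows "exp (- (\<Sum>l\<in>F. m l * (1 - (ph_dist l z)\<^sup>2)) / (2 * \<tau>\<^sup>2)) \<le> norm (finite_blaschke m F z)"
proof (cases "finite F")
  case True
  have *: "- (\<Sum>l\<in>F. m l * r l) / c = (\<Sum>l\<in>F. m l * (- r l / c))" for r :: "complex \<Rightarrow> real" and c
    by (simp add: sum_divide_distrib flip: sum_negf)
  have "exp (- (\<Sum>l\<in>F. m l * (1 - (ph_dist l z)\<^sup>2)) / (2 * \<tau>\<^sup>2)) =
      exp (\<Sum>l\<in>F. m l * (- (1 - (ph_dist l z)\<^sup>2) / (2 * \<tau>\<^sup>2)))"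
    by (simp only: *)
  also have "\<dots> = (\<Prod>l\<in>F. exp (- (1 - (ph_dist l z)\<^sup>2) / (2 * \<tau>\<^sup>2)) ^ m l)"
    by (simp only: exp_sum[OF True] exp_of_nat_mult)
  also have "\<dots> \<le> (\<Prod>l\<in>F. ph_dist l z ^ m l)"
    using assms by (intro prod_mono conjI power_mono exp_neg_one_minus_square_le ph_dist_less_1) auto
  finally show ?thesis by (simp add: norm_finite_blaschke)
next
  case False
  then show ?thesis by (simp add: finite_blaschke_def)
qed

text \<open>The finite products over an exhaustion of \<open>A\<close> are bounded by \<open>1\<close>, so Montel's theorem provides a limit. It
inherits each upper bound by a single factor and each lower bound common to all finite products.\<close>

lemma blaschke_limit:
  assumes A: "A \<subseteq> ball 0 1" "countable A"
  obtains B where "B holomorphic_on ball 0 1"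
    "\<And>z. norm z < 1 \<Longrightarrow> norm (B z) \<le> 1"
    "\<And>l z. l \<in> A \<Longrightarrow> norm z < 1 \<Longrightarrow> norm (B z) \<le> ph_dist l z ^ m l"
    "\<And>z c. norm z < 1 \<Longrightarrow> (\<And>F. finite F \<Longrightarrow> F \<subseteq> A \<Longrightarrow> c \<le> norm (finite_blaschke m F z)) \<Longrightarrow> c \<le> norm (B z)"
proof -
  define F where "F = (\<lambda>n. A \<inter> from_nat_into A ` {..<n::nat})"
  have F: "finite (F n)" "F n \<subseteq> A" "F n \<subseteq> ball 0 1" for n using A by (auto simp: F_def)
  have exhaust: "\<exists>N. \<forall>n\<ge>N. l \<in> F n" if l: "l \<in> A" for l
  proof -
    obtain k where "l = from_nat_into A k"
      using from_nat_into_surj[OF A(2) l] by metis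
    then show ?thesis using l by (intro exI[of _ "Suc k"]) (auto simp: F_def)
  qed
  define H where "H = {h. h holomorphic_on ball 0 1 \<and> (\<forall>z\<in>ball 0 1. norm (h z) \<le> 1)}"
  have bdd: "\<exists>B. \<forall>h\<in>H. \<forall>z\<in>K. norm (h z) \<le> B" if "compact K" "K \<subseteq> ball 0 1" for K :: "complex set"
    using that by (intro exI[of _ 1]) (auto simp: H_def)
  have rng: "range (\<lambda>n. finite_blaschke m (F n)) \<subseteq> H"
    using finite_blaschke_holomorphic[OF F(3)] norm_finite_blaschke_le_1[OF F(3)] by (auto simp: H_def)
  obtain B r where B: "B holomorphic_on ball 0 1" "strict_mono (r :: nat \<Rightarrow> nat)"
    "\<And>x. x \<in> ball 0 1 \<Longrightarrow> (\<lambda>n. finite_blaschke m (F (r n)) x) \<longlonglongrightarrow> B x"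
  proof (rule Montel[OF open_ball _ bdd rng])
    show "h holomorphic_on ball 0 1" if "h \<in> H" for h using that by (simp add: H_def)
  qed auto
  have lim: "(\<lambda>n. norm (finite_blaschke m (F (r n)) z)) \<longlonglongrightarrow> norm (B z)" if "norm z < 1" for z
    using B(3)[of z] that by (intro tendsto_norm) auto
  show thesis
  proof (rule that[OF B(1)])
    show "norm (B z) \<le> 1" if "norm z < 1" for z
      using norm_finite_blaschke_le_1[OF F(3) that] by (intro LIMSEQ_le_const2[OF lim[OF that]]) blast
    show "norm (B z) \<le> ph_dist l z ^ m l" if l: "l \<in> A" and z: "norm z < 1" for l z
    proof (rule LIMSEQ_le_const2[OF lim[OF z]])
      obtain N where N: "\<And>n. n \<ge> N \<Longrightarrow> l \<in> F n" using exhaust[OF l] by blast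
      have "norm (finite_blaschke m (F (r n)) z) \<le> ph_dist l z ^ m l" if "n \<ge> N" for n
        using N[of "r n"] seq_suble[OF B(2), of n] that F z
        by (intro norm_finite_blaschke_le_factor) auto
      then show "\<exists>N. \<forall>n\<ge>N. norm (finite_blaschke m (F (r n)) z) \<le> ph_dist l z ^ m l" by blast
    qed
    show "c \<le> norm (B z)"
      if "norm z < 1" "\<And>F. finite F \<Longrightarrow> F \<subseteq> A \<Longrightarrow> c \<le> norm (finite_blaschke m F z)" for z c
      by (rule LIMSEQ_le_const[OF lim[OF that(1)]]) (use F that(2) in blast)
  qed
qed

section \<open>Convergence excludes sampling\<close>

lemma constant_in_Har_plus: "c \<ge> 0 \<Longrightarrow> (\<lambda>_. c) \<in> Har_plus"
  unfolding Har_plus_def harmonic_on_def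
  by (auto intro!: exI[of _ "\<lambda>_. 0"])

text \<open>The means increase with the radius and are bounded by the constant mean of the harmonic majorant, hence
they converge.\<close>

lemma nevanlinna_if_dominated:
  assumes f: "f holomorphic_on ball 0 1" and p: "p holomorphic_on ball 0 1"
    and le: "\<And>z. norm z < 1 \<Longrightarrow> log_plus (norm (f z)) \<le> Re (p z)"
  shows "f \<in> nevanlinna"
proof -
  define \<mu> where "\<mu> = circle_mean (\<lambda>z. log_plus (norm (f z)))"
  have mono: "\<mu> r \<le> \<mu> R" if "0 < r" "r \<le> R" "R < 1" for r R
    unfolding \<mu>_def using that f
    by (intro subharmonic_circle_mean_mono support_subharmonic_log_plus_norm continuous_on_log_plus_norm) auto
  have bd: "\<mu> r \<le> Re (p 0)" if r: "0 < r" "r < 1" for r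
  proof -
    have sub: "sphere 0 r \<subseteq> ball (0::complex) 1" "cball 0 r \<subseteq> ball (0::complex) 1" using r by auto
    have "\<mu> r \<le> circle_mean (\<lambda>z. Re (p z)) r"
      unfolding \<mu>_def
      using r holomorphic_on_imp_continuous_on[OF holomorphic_on_subset[OF p sub(1)]]
      by (intro circle_mean_mono continuous_on_log_plus_norm holomorphic_on_subset[OF f sub(1)]
          continuous_on_Re le) auto
    also have "\<dots> = Re (p 0)"
      using r by (intro circle_mean_Re_holomorphic holomorphic_on_subset[OF p sub(2)])
    finally show ?thesis .
  qed
  have "(\<mu> \<longlongrightarrow> Sup (\<mu> ` ({..<1} \<inter> {0<..}))) (at 1 within ({..<1} \<inter> {0<..}))"
    using mono bd by (intro Lim_left_bound[where K = "Re (p 0)"]) auto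
  moreover have "at 1 within ({..<1} \<inter> {0<..}) = at_left (1::real)"
    by (rule at_within_nhd[of _ "{0<..}"]) auto
  ultimately show ?thesis
    using f unfolding nevanlinna_def \<mu>_def circle_mean_def by auto
qed

text \<open>At the point of the radius with half-plane coordinate \<open>x\<close>, the Harnack factor \<open>(1 + r) / (1 - r)\<close> is
\<open>x\<close> itself, the same as the value of the Poisson kernel there.\<close>

lemma Har_plus_radial_Harnack:
  assumes h: "h \<in> Har_plus" and x: "x \<ge> 1"
  shows "h (disc_point x) \<le> x * h 0"
proof -
  obtain F where F: "F holomorphic_on ball 0 1" "\<And>w. norm w < 1 \<Longrightarrow> h w = Re (F w)"
    "\<And>w. norm w < 1 \<Longrightarrow> 0 \<le> h w"
    using Har_plusE[OF h] by blast
  have n: "norm (disc_point x) = (x - 1) / (x + 1)"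
    using x unfolding disc_point_def norm_of_real by simp
  have "(1 + norm (disc_point x)) / (1 - norm (disc_point x)) = x"
    unfolding n using x by (simp add: field_simps)
  then show ?thesis
    using Harnack_at_centre(2)[OF F(1), of "disc_point x"] F(2,3) disc_point(1)[of x] x
    by simp
qed

text \<open>The function \<open>f = B * exp (M * cayley)\<close> has \<open>Nev f \<ge> M - 1 / 2\<close>, although \<open>Nev_on f\<close> for the union of small
discs is at most \<open>ln (1 + exp K)\<close>, where \<open>K\<close> is the Harnack constant of a disc of radius \<open>c\<close>.\<close>

theorem not_sampling_if_series_converges:
  fixes \<phi> :: "real \<Rightarrow> real"
  assumes \<Lambda>: "uniformly_dense \<Lambda>"
    and \<phi>: "\<And>t. t \<in> {0<..1} \<Longrightarrow> \<phi> t \<in> {0<..<1}" "mono_on {0<..1} \<phi>"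
    and bounded: "\<exists>c<1. \<forall>t\<in>{0<..1}. \<phi> t \<le> c"
    and conv: "\<And>q. 0 < q \<Longrightarrow> q < 1 \<Longrightarrow> summable (\<lambda>m. 1 / ln (1 / \<phi> (q ^ m)))"
  shows "\<not> sampling_nevanlinna (disc_union \<Lambda> \<phi>)"
proof
  assume "sampling_nevanlinna (disc_union \<Lambda> \<phi>)"
  then obtain C where C: "C > 0"
    "\<And>f. f \<in> nevanlinna \<Longrightarrow> Nev f \<le> Nev_on f (disc_union \<Lambda> \<phi>) + ereal C"
    unfolding sampling_nevanlinna_def by blast
  obtain c where c: "c < 1" "\<And>t. t \<in> {0<..1} \<Longrightarrow> \<phi> t \<le> c" using bounded by blast
  have c0: "c > 0" using c(2)[of 1] \<phi>(1)[of 1] by simp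
  have sub: "\<Lambda> \<subseteq> ball 0 1" and "separated \<Lambda>" using \<Lambda> by (auto simp: uniformly_dense_def)
  then obtain \<delta>' where \<delta>': "\<delta>' > 0" "\<And>z w. z \<in> \<Lambda> \<Longrightarrow> w \<in> \<Lambda> \<Longrightarrow> z \<noteq> w \<Longrightarrow> \<delta>' \<le> ph_dist z w"
    unfolding separated_def by blast
  define \<delta> where "\<delta> = min \<delta>' 1"
  have \<delta>: "0 < \<delta>" "\<delta> \<le> 1" and sep: "\<And>z w. z \<in> \<Lambda> \<Longrightarrow> w \<in> \<Lambda> \<Longrightarrow> z \<noteq> w \<Longrightarrow> \<delta> \<le> ph_dist z w"
    using \<delta>' by (auto simp: \<delta>_def min_le_iff_disj)
  define K where "K = (1 + c) / (1 - c)"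
  have K: "K > 0" using c c0 by (simp add: K_def)
  define C1 where "C1 = ln (1 + exp K)"
  have C1: "C1 > 0" by (simp add: C1_def add_pos_pos)
  \<comment> \<open>With this \<open>M\<close>, the lower bound \<open>M - 1 / 2\<close> for \<open>Nev f\<close> exceeds \<open>C1 + C\<close>.\<close>
  define M where "M = C1 + C + 1"
  have M: "M > 0" using C C1 by (simp add: M_def)
  define A where "A = {z\<in>\<Lambda>. 1 \<le> M * Re (cayley z)}"
  have A: "A \<subseteq> ball 0 1" using sub by (auto simp: A_def)
  define L where "L = (\<lambda>l::complex. ln (1 / \<phi> (1 - norm l)))"
  have dist_in: "1 - norm l \<in> {0<..1}" if "norm l < 1" for l :: complex using that by auto
  have Lpos: "L l > 0" if "norm l < 1" for l
    using \<phi>(1)[OF dist_in[OF that]] by (simp add: L_def)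
  define m where "m = (\<lambda>l. nat \<lceil>K * M * Re (cayley l) / L l\<rceil>)"
  have m_lo: "K * M * Re (cayley l) / L l \<le> m l" for l
    unfolding m_def by (rule real_nat_ceiling_ge)
  have m_hi: "m l \<le> K * M * Re (cayley l) / L l + 1" if "l \<in> A" for l
  proof -
    have "norm l < 1" using that A by auto
    then have "0 \<le> K * M * Re (cayley l) / L l"
      using K M Re_cayley_pos[of l] Lpos[of l] by simp
    then show ?thesis unfolding m_def by linarith
  qed
  note W = blaschke_weights_bounded[OF sub \<delta>(1) sep \<phi> conv M less_imp_le[OF mult_pos_pos[OF K M]] A_def
      m_hi[unfolded L_def]]
  obtain S where S: "\<And>F. finite F \<Longrightarrow> F \<subseteq> A \<Longrightarrow> (\<Sum>l\<in>F. m l * Re (cayley l) / (norm (1 + cayley l))\<^sup>2) \<le> S"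
    using W(2) by blast
  obtain B where B: "B holomorphic_on ball 0 1" "\<And>z. norm z < 1 \<Longrightarrow> norm (B z) \<le> 1"
    "\<And>l z. l \<in> A \<Longrightarrow> norm z < 1 \<Longrightarrow> norm (B z) \<le> ph_dist l z ^ m l"
    "\<And>z c. norm z < 1 \<Longrightarrow> (\<And>F. finite F \<Longrightarrow> F \<subseteq> A \<Longrightarrow> c \<le> norm (finite_blaschke m F z)) \<Longrightarrow> c \<le> norm (B z)"
    using blaschke_limit[OF A W(1)] by blast
  define f where "f = (\<lambda>z. B z * exp (of_real M * cayley z))"
  have norm_f: "norm (f z) = norm (B z) * exp (M * Re (cayley z))" for z
    by (simp add: f_def norm_mult)
  have fhol: "f holomorphic_on ball 0 1"
    unfolding f_def by (intro holomorphic_intros B cayley_holomorphic)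
  have norm_f_le: "norm (f z) \<le> exp (M * Re (cayley z))" if "norm z < 1" for z
    unfolding norm_f using B(2)[OF that] by (simp add: mult_left_le_one_le)
  have "f \<in> nevanlinna"
  proof (rule nevanlinna_if_dominated[OF fhol])
    show "(\<lambda>z. of_real M * cayley z) holomorphic_on ball 0 1"
      by (intro holomorphic_intros cayley_holomorphic)
    show "log_plus (norm (f z)) \<le> Re (of_real M * cayley z)" if z: "norm z < 1" for z
    proof -
      have pos: "0 < M * Re (cayley z)" using M Re_cayley_pos[OF z] by simp
      have "ln (norm (f z)) \<le> M * Re (cayley z)"
      proof (cases "f z = 0")
        case False
        then show ?thesis using ln_mono[OF norm_f_le[OF z]] by simp
      qed (use pos in simp)
      then show ?thesis using pos by (simp add: log_plus_def)
    qed
  qed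
  then have le: "Nev f \<le> Nev_on f (disc_union \<Lambda> \<phi>) + ereal C" by (rule C)
  have "Nev_on f (disc_union \<Lambda> \<phi>) \<le> ereal C1"
    unfolding Nev_on_def
  proof (rule Inf_lower, intro CollectI exI[of _ "\<lambda>_. C1"] conjI ballI refl)
    show "(\<lambda>_. C1) \<in> Har_plus" using C1 by (intro constant_in_Har_plus) simp
    fix z assume "z \<in> disc_union \<Lambda> \<phi>"
    then obtain l where l: "l \<in> \<Lambda>" "norm z < 1" "ph_dist l z < \<phi> (1 - norm l)"
      by (auto simp: disc_union_def ph_disc_def)
    have l1: "norm l < 1" using l sub by auto
    note \<phi>l = \<phi>(1)[OF dist_in[OF l1]]
    have "ph_dist l z \<le> c" using l(3) c(2)[OF dist_in[OF l1]] by simp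
    then have Rz: "M * Re (cayley z) \<le> K * (M * Re (cayley l))"
      using Re_cayley_Harnack[OF l1 l(2) _ c(1)] M mult_left_mono[of _ _ M] by (fastforce simp: K_def mult_ac)
    \<comment> \<open>If \<open>l\<close> carries no zero, the exponential is bounded near \<open>l\<close>; otherwise the zero of order \<open>m l\<close> cancels it.\<close>
    have "norm (f z) \<le> exp K"
    proof (cases "l \<in> A")
      case False
      then have "M * Re (cayley l) \<le> 1" using l by (simp add: A_def)
      then have "M * Re (cayley z) \<le> K"
        using Rz mult_left_mono[of "M * Re (cayley l)" 1 K] K by linarith
      then show ?thesis using norm_f_le[OF l(2)] by (meson exp_le_cancel_iff order_trans)
    next
      case True
      have "norm (B z) \<le> ph_dist l z ^ m l" by (rule B(3)[OF True l(2)])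
      also have "\<dots> \<le> \<phi> (1 - norm l) ^ m l"
        using l(3) by (intro power_mono ph_dist_nonneg) simp
      also have "\<dots> = exp (- (m l * L l))"
        using \<phi>l by (simp add: L_def ln_div exp_of_nat_mult)
      also have "\<dots> \<le> exp (- (K * (M * Re (cayley l))))"
        using m_lo[of l] Lpos[OF l1] by (simp add: field_simps)
      finally have "norm (f z) \<le> exp (- (K * (M * Re (cayley l)))) * exp (M * Re (cayley z))"
        unfolding norm_f by (intro mult_right_mono) auto
      also have "\<dots> \<le> exp K"
        using Rz K by (simp flip: exp_add)
      finally show ?thesis .
    qed
    then show "ln (1 + norm (f z)) \<le> C1"
      unfolding C1_def by (intro ln_mono) (auto intro: add_pos_nonneg)
  qed
  moreover have "ereal (M - 1 / 2) \<le> Nev f"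
    unfolding Nev_def Nev_on_def
  proof (rule Inf_greatest, clarsimp)
    fix h assume h: "h \<in> Har_plus" "\<forall>z\<in>unit_disc. ln (1 + norm (f z)) \<le> h z"
    define \<tau> where "\<tau> = \<delta> / 16"
    have \<tau>: "\<tau> > 0" using \<delta> by (simp add: \<tau>_def)
    obtain X where X: "X \<ge> 1" "\<And>x F. x \<ge> X \<Longrightarrow> finite F \<Longrightarrow> F \<subseteq> A \<Longrightarrow>
        (\<Sum>l\<in>F. m l * Re (cayley l) / (norm (of_real x + cayley l))\<^sup>2) \<le> \<tau>\<^sup>2 / 4"
      using shifted_sums_small[of A "\<lambda>l. real (m l)" cayley S "\<tau>\<^sup>2 / 4"] S A \<tau> Re_cayley_pos
      by (auto simp: subset_iff)
    \<comment> \<open>A point of the radius that keeps away from all zeros, so far out that the sum over the zeros is at most \<open>\<tau>\<^sup>2 / 4\<close>.\<close>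
    obtain x where x: "x \<ge> X" "\<And>l. l \<in> \<Lambda> \<Longrightarrow> \<tau> \<le> ph_dist l (disc_point x)"
      using separated_avoids_radial_points[OF sub \<delta> sep, of X] X(1) unfolding \<tau>_def by auto
    have x1: "x \<ge> 1" using x X by simp
    have p: "norm (disc_point x) < 1" "cayley (disc_point x) = of_real x" using disc_point x1 by auto
    have "exp (- x / 2) \<le> norm (B (disc_point x))"
    proof (rule B(4)[OF p(1)])
      fix F assume F: "finite F" "F \<subseteq> A"
      have "(\<Sum>l\<in>F. m l * (1 - (ph_dist l (disc_point x))\<^sup>2)) =
          (\<Sum>l\<in>F. 4 * x * (m l * Re (cayley l) / (norm (of_real x + cayley l))\<^sup>2))"
      proof (rule sum.cong[OF refl])
        fix l assume "l \<in> F"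
        then have "norm l < 1" using F A by auto
        from one_minus_ph_dist_sq_cayley[OF this p(1)]
        show "m l * (1 - (ph_dist l (disc_point x))\<^sup>2) =
            4 * x * (m l * Re (cayley l) / (norm (of_real x + cayley l))\<^sup>2)"
          unfolding p(2) by (simp add: add.commute)
      qed
      also have "\<dots> = 4 * x * (\<Sum>l\<in>F. m l * Re (cayley l) / (norm (of_real x + cayley l))\<^sup>2)"
        by (simp add: sum_distrib_left)
      also have "\<dots> \<le> 4 * x * (\<tau>\<^sup>2 / 4)"
        using X(2)[OF x(1) F] x1 by (intro mult_left_mono) auto
      finally have "(\<Sum>l\<in>F. m l * (1 - (ph_dist l (disc_point x))\<^sup>2)) / (2 * \<tau>\<^sup>2) \<le> x / 2"
        using \<tau> by (simp add: field_simps)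
      then have "exp (- x / 2) \<le> exp (- (\<Sum>l\<in>F. m l * (1 - (ph_dist l (disc_point x))\<^sup>2)) / (2 * \<tau>\<^sup>2))"
        by simp
      also have "\<dots> \<le> norm (finite_blaschke m F (disc_point x))"
        using F A x(2) \<tau> p(1) by (intro norm_finite_blaschke_ge) (auto simp: A_def)
      finally show "exp (- x / 2) \<le> norm (finite_blaschke m F (disc_point x))" .
    qed
    then have "exp (- x / 2) * exp (M * x) \<le> norm (f (disc_point x))"
      unfolding norm_f p(2) by simp
    then have "exp (x * (M - 1 / 2)) \<le> 1 + norm (f (disc_point x))"
      by (simp add: algebra_simps flip: exp_add)
    then have "x * (M - 1 / 2) \<le> ln (1 + norm (f (disc_point x)))"
      by (subst ln_ge_iff) (auto intro: add_pos_nonneg)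
    also have "\<dots> \<le> h (disc_point x)" using h(2) p(1) by simp
    also have "\<dots> \<le> x * h 0" by (rule Har_plus_radial_Harnack[OF h(1) x1])
    finally show "M - 1 / 2 \<le> h 0" using x1 by simp
  qed
  ultimately have "ereal (M - 1 / 2) \<le> ereal C1 + ereal C"
    using le by (meson add_right_mono order_trans)
  then show False by (simp add: M_def)
qed

section \<open>The characterization\<close>

theorem theorem4p6:
  fixes \<Lambda> :: "complex set" and \<phi> :: "real \<Rightarrow> real"
  assumes "uniformly_dense \<Lambda>"
    and "\<And>t. t \<in> {0<..1} \<Longrightarrow> \<phi> t \<in> {0<..<1}"
    and "mono_on {0<..1} \<phi>"
    and "continuous_on {0<..1} \<phi>"
    and "\<exists>c<1. \<forall>t\<in>{0<..1}. \<phi> t \<le> c"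
  shows "sampling_nevanlinna (disc_union \<Lambda> \<phi>) \<longleftrightarrow>
         (\<integral>\<^sup>+ t \<in> {0<..1}. ennreal (1 / (t * ln (1 / \<phi> t))) \<partial>lborel) = \<infinity>"
proof -
  have test: "(\<integral>\<^sup>+ t \<in> {0<..1}. ennreal (1 / (t * ln (1 / \<phi> t))) \<partial>lborel) = \<infinity> \<longleftrightarrow>
      \<not> summable (\<lambda>m. 1 / ln (1 / \<phi> (q ^ m)))" if "0 < q" "q < 1" for q
    by (rule integral_infinite_iff_geometric_series_diverges[OF _ assms(3,4) that]) (rule assms(2))
  show ?thesis
  proof
    assume "(\<integral>\<^sup>+ t \<in> {0<..1}. ennreal (1 / (t * ln (1 / \<phi> t))) \<partial>lborel) = \<infinity>"
    then have div: "\<not> summable (\<lambda>m. 1 / ln (1 / \<phi> (q ^ m)))" if "0 < q" "q < 1" for q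
      using test[OF that] by simp
    show "sampling_nevanlinna (disc_union \<Lambda> \<phi>)"
      by (rule sampling_if_series_diverges[OF assms(1) _ assms(3) div]) (rule assms(2))
  next
    assume sampling: "sampling_nevanlinna (disc_union \<Lambda> \<phi>)"
    show "(\<integral>\<^sup>+ t \<in> {0<..1}. ennreal (1 / (t * ln (1 / \<phi> t))) \<partial>lborel) = \<infinity>"
    proof (rule ccontr)
      assume "\<not> ?thesis"
      then have conv: "summable (\<lambda>m. 1 / ln (1 / \<phi> (q ^ m)))" if "0 < q" "q < 1" for q
        using test[OF that] by blast
      have "\<not> sampling_nevanlinna (disc_union \<Lambda> \<phi>)"
        by (rule not_sampling_if_series_converges[OF assms(1) _ assms(3,5) conv]) (rule assms(2))
      then show False using sampling by blast
    qed
  qed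
qed

end
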